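(* Let $F$ be a finite field of characteristic $p$ and order $q=p^n$, and let $d$ be a positive integer with $\gcd(d,q-1)=1$ and $d\not\equiv1\pmod{p-1}$. If $d\equiv (p+1)/2\pmod{p-1}$ (which can only happen if $p\equiv1\pmod 4$) and $n$ is odd, then $V_{F,d}\le\frac12[F:\mathbb{F}_p]$. Otherwise $V_{F,d}\le\frac{1}{p-1}\left\lceil\frac{p-1}{3}\right\rceil[F:\mathbb{F}_p]$.
   Context: $\psi$ is the canonical additive character of $F$, $\psi(x)=e^{2\pi i\operatorname{Tr}(x)/p}$ with $\operatorname{Tr}$ the absolute trace $F\to\mathbb{F}_p$. For $a\in F$, $W_{F,d}(a)=\sum_{x\in F}\psi(x^d-ax)$, and $V_{F,d}=\min_{a\in F}\operatorname{val}_p(W_{F,d}(a))$, where $\operatorname{val}_p$ is the $p$-adic valuation extended to $\mathbb{Q}(e^{2\pi i/p})$ with $\operatorname{val}_p(1-e^{2\pi i/p})=1/(p-1)$ (so $\operatorname{val}_p(p)=1$). *)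

theory Defs
  imports
    Complex_Main
    "HOL-Library.Extended_Real"
    "HOL-Library.Cardinality"
    "HOL-Computational_Algebra.Computational_Algebra"
    "HOL-Number_Theory.Cong"
begin

(* The degree of F over its prime field, read off from the order of F. *)
definition ff_degree :: "'a::finite_field itself \<Rightarrow> nat" where
  "ff_degree _ = (THE n. CARD('a) = CHAR('a) ^ n)"

definition abs_trace :: "'a::finite_field \<Rightarrow> 'a" where
  "abs_trace x = (\<Sum>i<ff_degree TYPE('a). x ^ (CHAR('a) ^ i))"

(* The representative in {0..<p} of an element of the prime field of F. *)
definition prime_field_rep :: "'a::finite_field \<Rightarrow> nat" where
  "prime_field_rep y = (THE k. k < CHAR('a) \<and> of_nat k = y)"

definition canonical_char :: "'a::finite_field \<Rightarrow> complex" where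
  "canonical_char x =
     exp (2 * of_real pi * \<i> * of_nat (prime_field_rep (abs_trace x)) / of_nat CHAR('a))"

definition weil_sum :: "nat \<Rightarrow> 'a::finite_field \<Rightarrow> complex" where
  "weil_sum d a = (\<Sum>x\<in>UNIV. canonical_char (x ^ d - a * x))"

definition zeta :: "nat \<Rightarrow> complex" where
  "zeta p = exp (2 * of_real pi * \<i> / of_nat p)"

(* The ring Z[zeta_p]. *)
definition cyclotomic_ints :: "nat \<Rightarrow> complex set" where
  "cyclotomic_ints p = range (\<lambda>f :: int poly. poly (map_poly of_int f) (zeta p))"

(* The complement in Z[zeta_p] of the principal ideal generated by 1 - zeta_p,
   which is the unique prime ideal above p. *)
definition prime_to_p :: "nat \<Rightarrow> complex set" where
  "prime_to_p p = cyclotomic_ints p - (\<lambda>u. (1 - zeta p) * u) ` cyclotomic_ints p"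

(* The p-adic valuation on Q(zeta_p).  A nonzero element of Q(zeta_p) is
   (1 - zeta_p)^k * a / b with a, b in Z[zeta_p] outside the prime above p, for a unique
   integer k; its valuation is k / (p - 1), so that 1 - zeta_p has valuation 1 / (p - 1)
   and p has valuation 1.  Values outside Q(zeta_p) are unspecified. *)
definition val_p :: "nat \<Rightarrow> complex \<Rightarrow> ereal" where
  "val_p p z =
     (if z = 0 then \<infinity>
      else ereal (of_int (THE k :: int. \<exists>a\<in>prime_to_p p. \<exists>b\<in>prime_to_p p.
                    z = (1 - zeta p) powi k * a / b) / (real p - 1)))"

definition weil_val :: "'a::finite_field itself \<Rightarrow> nat \<Rightarrow> ereal" where
  "weil_val _ d = Min (range (\<lambda>a :: 'a. val_p CHAR('a) (weil_sum d a)))"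

end

theory Submission
  imports "HOL-Number_Theory.Residues" Defs
begin

text \<open>
  Let \<open>T\<close> be the Teichmueller lift of the field, \<open>\<pi> = 1 - zeta p\<close>, and let \<open>G a\<close> be the Gauss sum of the
  character \<open>T\<^sup>-\<^sup>a\<close>. If \<open>q - 1\<close> divides \<open>d * a + b\<close> but not \<open>b\<close>, the Fourier coefficient of the Weil sum at
  \<open>T\<^sup>-\<^sup>b\<close> is \<open>G a * G b\<close> up to sign, so some Weil sum is at most as divisible by \<open>\<pi>\<close> as \<open>G a * G b\<close>.
  Of Stickelberger's theorem only the easy half is needed: \<open>G (a + b)\<close> divides \<open>G a * G b\<close> (Jacobi sums),
  \<open>G (p * a) = G a\<close>, and \<open>G 1\<close> is \<open>\<pi>\<close> times a local unit, hence \<open>G a\<close> divides \<open>\<pi>\<close> to the power of the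
  base-\<open>p\<close> digit sum of \<open>a\<close>. It remains to find \<open>a\<close> and \<open>b\<close> of small total digit sum. Constant digits \<open>k\<close> and
  \<open>l\<close> with \<open>p - 1\<close> dividing \<open>d * k + l\<close> suffice unless \<open>d \<equiv> (p + 1) / 2\<close> modulo \<open>p - 1\<close>; in that case, for
  even \<open>n\<close>, digits of period two give total digit sum \<open>(p - 1) / 2\<close> per period.
\<close>

section \<open>Digits of small total weight\<close>

text \<open>A slow Euclidean algorithm on the lattice of pairs \<open>(t, y)\<close> with \<open>y \<equiv> e * t\<close> modulo \<open>M\<close>: the current
  basis is \<open>(tP, y)\<close>, \<open>(tQ, - x)\<close>, and their sum replaces one of the two. The determinant relation
  \<open>tP * x + tQ * y = M\<close> keeps \<open>t\<close> below about \<open>M / 3\<close> when the second vector first gets \<open>x \<le> 2 * tQ\<close>.\<close>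

lemma lattice_descent:
  fixes M e :: int
  assumes "tP \<ge> 1" "tQ \<ge> 0" "y \<ge> 1" "x > 2 * tQ" "tP * x + tQ * y = M"
    and "M dvd e * tP - y" "M dvd e * tQ + x"
  shows "\<exists>t k. t \<ge> 1 \<and> 0 \<le> k \<and> k \<le> 2 * t \<and> 3 * t \<le> M + 2 \<and> M dvd e * t + k"
  using assms
proof (induction "nat (x + y)" arbitrary: tP tQ x y rule: less_induct)
  case less
  note asm = less.prems
  have sum: "M dvd e * (tP + tQ) + (x - y)"
    using dvd_add[OF asm(6,7)] by (simp add: algebra_simps)
  show ?case
  proof (cases "y > x")
    case True
    show ?thesis
    proof (rule less.hyps[of x "y - x" "tP + tQ" tQ])
      show "M dvd e * (tP + tQ) - (y - x)" using sum by (simp add: algebra_simps)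
    qed (use asm True in \<open>auto simp: algebra_simps\<close>)
  next
    case False
    show ?thesis
    proof (cases "x - y \<le> 2 * (tP + tQ)")
      case good: True
      have "3 * (tP + tQ) \<le> M + 2"
      proof (cases "tQ = 0")
        case True
        hence "M dvd x" "tP * x = M" "x > 0" using asm by auto
        hence "M \<le> x" by (auto intro: zdvd_imp_le)
        hence "tP * x \<le> 1 * x" using \<open>tP * x = M\<close> by simp
        hence "tP \<le> 1" using \<open>x > 0\<close> by (simp only: mult_le_cancel_right_pos)
        thus ?thesis using True asm \<open>tP * x = M\<close> \<open>x > 0\<close> by auto
      next
        case False
        hence q: "tQ \<ge> 1" using asm by simp
        have px: "tP * (x - 3) \<ge> 1 * (x - 3)" using asm q by (intro mult_right_mono) auto
        \<comment> \<open>By the determinant relation this is the bound on \<open>tP + tQ\<close>.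
          The second product is negative only for \<open>y = 1\<close> or \<open>y = 2\<close>, and
          then \<open>x > 2 * tQ\<close> makes the first one large enough.\<close>
        have "tP * (x - 3) + tQ * (y - 3) \<ge> -2"
        proof -
          consider "y = 1" | "y = 2" | "y \<ge> 3" using asm by linarith
          thus ?thesis
          proof cases
            case 3
            hence "tQ * (y - 3) \<ge> 0" using q by simp
            moreover have "tP * (x - 3) \<ge> 0" using asm q by simp
            ultimately show ?thesis by linarith
          qed (use px asm q in auto)
        qed
        thus ?thesis using asm(5) by (simp add: algebra_simps)
      qed
      thus ?thesis using good False asm sum by (intro exI[of _ "tP + tQ"] exI[of _ "x - y"]) auto
    next
      case bad: False
      show ?thesis
        by (rule less.hyps[of "x - y" y tP "tP + tQ"])
          (use asm False bad sum in \<open>auto simp: algebra_simps\<close>)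
    qed
  qed
qed

text \<open>Applied with \<open>m = p - 1\<close>: the bound then says exactly that
  \<open>k + l\<close> is at most the ceiling of \<open>(p - 1) / 3\<close>, and the last hypothesis
  rules out the class of \<open>(p + 1) / 2\<close>.\<close>

lemma exists_small_weight_pair:
  fixes m d :: int
  assumes m: "m > 0" "even m" "m mod 3 \<noteq> 2" and d: "odd d"
    and d1: "\<not> m dvd d - 1" and d2: "\<not> m dvd d - 1 - m div 2"
  shows "\<exists>k l. k \<ge> 0 \<and> l \<ge> 0 \<and> 3 * (k + l) \<le> m + 2 \<and> m dvd d * k + l \<and> \<not> m dvd k"
proof -
  \<comment> \<open>With \<open>c * (1 - d) \<equiv> g\<close> modulo \<open>m\<close>, any \<open>k \<equiv> c * t\<close> modulo \<open>M = m / g\<close> and \<open>l = g * t - k\<close> satisfy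
    \<open>m dvd d * k + l\<close>; so it suffices to have \<open>0 \<le> k \<le> g * t\<close> and \<open>t\<close> small.\<close>
  define g where "g = gcd (1 - d) m"
  have gpos: "g > 0" using m by (simp add: g_def)
  have "2 dvd g" using m d by (simp add: g_def)
  obtain M where M: "m = g * M" unfolding g_def by (metis gcd_dvd2 dvdE)
  have Mpos: "M > 0" using M m gpos by (simp add: zero_less_mult_iff)
  obtain f where f: "1 - d = g * f" unfolding g_def by (metis gcd_dvd1 dvdE)
  \<comment> \<open>\<open>M\<close> is the additive order of \<open>1 - d\<close> modulo
    \<open>m\<close>. Order 1 means that \<open>d\<close> is congruent to \<open>1\<close>, order 2
    that it is congruent to \<open>1 + m div 2\<close>; both are excluded.\<close>
  have "M \<noteq> 1"
  proof
    assume "M = 1"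
    hence "m dvd 1 - d" using M f by simp
    thus False using d1 by (metis dvd_minus_iff minus_diff_eq)
  qed
  moreover have "M \<noteq> 2"
  proof
    assume M2: "M = 2"
    hence mg: "m = g * 2" using M by simp
    show False
    proof (cases "even f")
      case True
      then obtain f' where "f = 2 * f'" by blast
      hence "d - 1 = m * (- f')" using f mg by (simp add: algebra_simps)
      thus False using d1 by simp
    next
      case False
      then obtain f' where "f = 2 * f' + 1" by (metis oddE)
      hence "d - 1 - m div 2 = m * (- f' - 1)" using f mg by (simp add: algebra_simps)
      thus False using d2 by simp
    qed
  qed
  ultimately have M3: "M \<ge> 3" using Mpos by linarith
  obtain c v where cv: "c * (1 - d) + v * m = g"
    using bezout_int[of "1 - d" m] unfolding g_def by blast
  have main: ?thesis if t: "t \<ge> 1" and k: "0 \<le> k" "k \<le> g * t" and b: "3 * (g * t) \<le> m + 2"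
    and dv: "M dvd c * t - k" for t k
  proof (intro exI conjI)
    obtain j where j: "c * t - k = M * j" using dv by blast
    have "d * k + (g * t - k) = g * t - (1 - d) * k" by (simp add: algebra_simps)
    also have "\<dots> = (c * (1 - d) + v * m) * t - (1 - d) * k" by (simp add: cv)
    also have "\<dots> = (1 - d) * (c * t - k) + m * (v * t)" by (simp add: algebra_simps)
    also have "\<dots> = m * (f * j + v * t)" unfolding j f M by (simp add: algebra_simps)
    finally have dd: "d * k + (g * t - k) = m * (f * j + v * t)" .
    thus "m dvd d * k + (g * t - k)" by simp
    have gt: "0 < g * t" using t gpos by simp
    have "m \<ge> 3" using M M3 gpos by (smt (verit) mult_le_cancel_right1 mult_less_cancel_right2)
    hence lt: "g * t < m" using b by linarith
    \<comment> \<open>Divisibility would force \<open>k = 0\<close>, and then \<open>m\<close> would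
      divide \<open>l = g * t\<close>, which lies strictly between \<open>0\<close> and
      \<open>m\<close>.\<close>
    show "\<not> m dvd k"
    proof
      assume "m dvd k"
      hence "k = 0" using k lt zdvd_not_zless[of k m] by (cases "k = 0") auto
      hence "m dvd g * t" using dd by simp
      thus False using gt lt zdvd_not_zless by blast
    qed
  qed (use k b in auto)
  show ?thesis
  \<comment> \<open>Once \<open>g * t >= M - 1\<close>, the integers from \<open>0\<close> to
    \<open>g * t\<close> meet every residue class modulo \<open>M\<close>. For \<open>g >= 4\<close>
    the least such \<open>t\<close> is already small enough.\<close>
  proof (cases "g \<ge> 4")
    case g4: True
    show ?thesis
    proof (cases "M - 1 \<le> g")
      case True
      have "c mod M < M" using Mpos by simp
      hence "c mod M \<le> g" using True by linarith
      moreover have "3 * g \<le> g * M" using M3 gpos by simp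
      moreover have "M dvd c - c mod M" by (simp add: mod_eq_dvd_iff[symmetric])
      ultimately show ?thesis using Mpos by (intro main[of 1 "c mod M"]) (auto simp: M)
    next
      case False
      define t where "t = (M + g - 2) div g"
      have tt: "g * t + (M + g - 2) mod g = M + g - 2" by (simp add: t_def)
      have r: "0 \<le> (M + g - 2) mod g" "(M + g - 2) mod g \<le> g - 1"
        using gpos pos_mod_bound[of g "M + g - 2"] by auto
      have lo: "M - 1 \<le> g * t" using tt r by linarith
      have hi: "g * t \<le> M + g - 2" using tt r by linarith
      have "g * t > 0" using lo M3 by linarith
      hence t1: "t \<ge> 1" using gpos by (simp add: zero_less_mult_iff)
      \<comment> \<open>Factored form of \<open>3 * (M + g - 2) <= g * M\<close>.\<close>
      have "(g - 3) * (M - 3) \<ge> 1 * 3" using g4 False by (intro mult_mono) auto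
      hence "3 * (g * t) \<le> m + 2" using hi by (simp add: M algebra_simps)
      moreover have "c * t mod M \<le> g * t" using pos_mod_bound[OF Mpos, of "c * t"] lo by linarith
      moreover have "M dvd c * t - c * t mod M" by (simp add: mod_eq_dvd_iff[symmetric])
      ultimately show ?thesis using Mpos t1 by (intro main[of t "c * t mod M"]) auto
    qed
  next
    case False
    hence g2: "g = 2" using gpos \<open>2 dvd g\<close> by (auto elim!: evenE)
    \<comment> \<open>Thus \<open>3 * t <= M + 2\<close> sharpens to \<open>3 * t <= M + 1\<close>,
      which doubles to the required bound.\<close>
    have M1: "M mod 3 \<noteq> 1" using m(3) unfolding M g2 by presburger
    \<comment> \<open>For \<open>g = 2\<close> the rounding argument loses too much, so
      \<open>t\<close> must depend on \<open>c\<close>. The descent runs with \<open>e = - c\<close>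
      from the basis \<open>(1, (- c) mod M)\<close>, \<open>(0, - M)\<close>.\<close>
    have "\<exists>t k. t \<ge> 1 \<and> 0 \<le> k \<and> k \<le> 2 * t \<and> 3 * t \<le> M + 2 \<and> M dvd (- c) * t + k"
    proof (cases "M dvd c")
      case True
      thus ?thesis using M3 by (intro exI[of _ 1] exI[of _ 0]) auto
    next
      case False
      hence "(- c) mod M \<noteq> 0" by (simp add: dvd_eq_mod_eq_0[symmetric])
      hence "(- c) mod M \<ge> 1" using Mpos pos_mod_sign[of M "- c"] by linarith
      moreover have "M dvd - c - (- c) mod M" by (simp add: mod_eq_dvd_iff[symmetric])
      ultimately show ?thesis using Mpos
        by (intro lattice_descent[of 1 0 "(- c) mod M" M]) auto
    qed
    then obtain t k where tk: "t \<ge> 1" "0 \<le> k" "k \<le> 2 * t" "3 * t \<le> M + 2" "M dvd (- c) * t + k"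
      by blast
    have "M dvd c * t - k" using tk(5)
      by (metis add.commute diff_conv_add_uminus dvd_minus_iff minus_diff_eq mult_minus_left)
    moreover have "3 * (g * t) \<le> m + 2"
      using tk(4) M1 unfolding M g2 by presburger
    ultimately show ?thesis using tk g2 by (intro main[of t k]) auto
  qed
qed

text \<open>Here \<open>2 * H - 1\<close> plays the role of \<open>p\<close>. It is congruent to
  \<open>1\<close> modulo \<open>2 * H - 2\<close>, so an odd \<open>a0 + a1\<close> forces the
  total digit sum to be congruent to \<open>H - 1\<close>. All witnesses have odd
  \<open>a0 + a1\<close> and attain this least possible total.\<close>

lemma exists_small_weight_two_digits:
  fixes H d :: int
  assumes H: "H \<ge> 7" and cop: "coprime d ((2 * H - 1)\<^sup>2 - 1)" and d: "[d = H] (mod (2 * H - 2))"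
  shows "\<exists>a0 a1 b0 b1. a0 \<ge> 0 \<and> a1 \<ge> 0 \<and> b0 \<ge> 0 \<and> b1 \<ge> 0 \<and> a0 + a1 + b0 + b1 = H - 1 \<and>
    (2 * H - 1)\<^sup>2 - 1 dvd d * (a0 + a1 * (2 * H - 1)) + (b0 + b1 * (2 * H - 1)) \<and>
    0 < a0 + a1 * (2 * H - 1) \<and> a0 + a1 * (2 * H - 1) < (2 * H - 1)\<^sup>2 - 1"
proof -
  define P where "P = (2 * H - 1)\<^sup>2 - 1"
  have P: "P = (2 * H - 2) * (2 * H)" by (simp add: P_def power2_eq_square algebra_simps)
  obtain j where j: "d - H = (2 * H - 2) * j" using d by (auto simp: cong_iff_dvd_diff)
  \<comment> \<open>\<open>b\<close> is chosen so that \<open>- d \<equiv> (H - 2) + (2 * H - 2) * b\<close> modulo \<open>P\<close>.\<close>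
  define b where "b = (- 1 - j) mod (2 * H)"
  have b: "0 \<le> b" "b < 2 * H" using H by (auto simp: b_def)
  obtain s where s: "1 + j + b = 2 * H * s"
  proof -
    have "2 * H dvd (- 1 - j) - b" unfolding b_def by (simp add: mod_eq_dvd_iff[symmetric])
    then obtain s where "(- 1 - j) - b = 2 * H * s" by blast
    hence "1 + j + b = 2 * H * (- s)" by (simp add: algebra_simps)
    thus ?thesis using that by blast
  qed
  have "d + (H - 2) + (2 * H - 2) * b = (2 * H - 2) * (1 + j + b)" using j by (simp add: algebra_simps)
  hence d_eq: "d = P * s - (H - 2) - (2 * H - 2) * b" unfolding s P by (simp add: algebra_simps)
  have small: "k * H < P" if "k \<le> 8" for k
  proof -
    have "k * H \<le> 8 * H" using that H by (intro mult_right_mono) auto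
    also have "8 * H < (2 * H - 2) * 2 * H" using H by (intro mult_strict_right_mono) auto
    finally show ?thesis by (simp add: P mult_ac)
  qed
  have H_ndvd: "\<not> H dvd d"
  proof
    assume "H dvd d"
    moreover have "H dvd P" by (simp add: P)
    ultimately have "is_unit H" using cop unfolding P_def[symmetric] by (meson coprime_common_divisor)
    thus False using H by (simp add: zdvd1_eq)
  qed
  \<comment> \<open>The values \<open>H - 1\<close> and \<open>2 * H - 1\<close> would make
    \<open>H\<close> a common divisor of \<open>d\<close> and \<open>P\<close>.\<close>
  have "b \<noteq> H - 1"
  proof
    assume bH: "b = H - 1"
    have "d = H * (4 * (H - 1) * s - (2 * H - 3))" unfolding d_eq bH P by (simp add: algebra_simps)
    thus False using H_ndvd by (metis dvd_triv_left)
  qed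
  moreover have "b \<noteq> 2 * H - 1"
  proof
    assume bH: "b = 2 * H - 1"
    have "d = H * (4 * (H - 1) * s - (4 * H - 5))" unfolding d_eq bH P by (simp add: algebra_simps)
    thus False using H_ndvd by (metis dvd_triv_left)
  qed
  \<comment> \<open>For \<open>b <= H - 2\<close> the digits of \<open>- d\<close> are
    \<open>H - 2 - b\<close> and \<open>b\<close>, so the multiplier \<open>1\<close> works. For
    larger \<open>b\<close> the first of these is negative; multipliers with digits (low one first)
    \<open>4, 1\<close> or \<open>1, 2\<close> or \<open>1, 4\<close> bring \<open>- d * a\<close>
    back to nonnegative digits with the right total.\<close>
  ultimately consider "b \<le> H - 2" | "b = H" | "H + 1 \<le> b \<and> b \<le> 2 * H - 3" | "b = 2 * H - 2"
    using b by linarith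
  moreover have witness: ?thesis if "a0 \<ge> 0" "a1 \<ge> 0" "b0 \<ge> 0" "b1 \<ge> 0" "a0 + a1 + b0 + b1 = H - 1"
      "P dvd d * (a0 + a1 * (2 * H - 1)) + (b0 + b1 * (2 * H - 1))"
      "0 < a0 + a1 * (2 * H - 1)" "a0 + a1 * (2 * H - 1) < P" for a0 a1 b0 b1
    using that unfolding P_def by blast
  ultimately show ?thesis
  proof cases
    case 1
    have "d * (1 + 0 * (2 * H - 1)) + ((H - 2 - b) + b * (2 * H - 1)) = P * s"
      unfolding d_eq by (simp add: algebra_simps)
    hence "P dvd d * (1 + 0 * (2 * H - 1)) + ((H - 2 - b) + b * (2 * H - 1))" by simp
    thus ?thesis using 1 b small[of 1] H
      by (intro witness[of 1 0 "H - 2 - b" b]) auto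
  next
    case 2
    have "d * (4 + 1 * (2 * H - 1)) + ((H - 6) + 0 * (2 * H - 1)) = P * (s * (2 * H + 3) - (H + 2))"
      unfolding d_eq 2 P by (simp add: algebra_simps)
    hence "P dvd d * (4 + 1 * (2 * H - 1)) + ((H - 6) + 0 * (2 * H - 1))" by simp
    thus ?thesis using small[of 3] H
      by (intro witness[of 4 1 "H - 6" 0]) auto
  next
    case 3
    have "d * (1 + 2 * (2 * H - 1)) + ((b - 1 - H) + (2 * H - 3 - b) * (2 * H - 1))
        = P * (s * (4 * H - 1) - 2 * b)"
      unfolding d_eq P by (simp add: algebra_simps)
    hence "P dvd d * (1 + 2 * (2 * H - 1)) + ((b - 1 - H) + (2 * H - 3 - b) * (2 * H - 1))" by simp
    thus ?thesis using 3 small[of 4] H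
      by (intro witness[of 1 2 "b - 1 - H" "2 * H - 3 - b"]) auto
  next
    case 4
    have "d * (1 + 4 * (2 * H - 1)) + ((H - 6) + 0 * (2 * H - 1)) = P * (s * (8 * H - 3) - (8 * H - 9))"
      unfolding d_eq 4 P by (simp add: algebra_simps)
    hence "P dvd d * (1 + 4 * (2 * H - 1)) + ((H - 6) + 0 * (2 * H - 1))" by simp
    thus ?thesis using small[of 8] H
      by (intro witness[of 1 4 "H - 6" 0]) auto
  qed
qed

section \<open>The Teichmueller lift\<close>

lemma finite_field_has_generator: "\<exists>g :: 'a :: finite_field. g \<noteq> 0 \<and> (\<forall>x. x \<noteq> 0 \<longrightarrow> (\<exists>i. x = g ^ i))"
proof -
  define F :: "'a ring" where
    "F = \<lparr>carrier = UNIV, monoid.mult = (*), one = 1, ring.zero = 0, add = (+)\<rparr>"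
  interpret F: Ring.field F
  proof (rule cring.cring_fieldI2)
    show "cring F"
      unfolding F_def
      by (intro cringI abelian_groupI comm_monoidI)
        (auto simp: algebra_simps intro: exI[of _ "- x" for x] add.left_inverse)
  qed (auto simp: F_def intro: right_inverse)
  have pow: "x [^]\<^bsub>F\<^esub> (i :: nat) = x ^ i" for x i
    by (induction i) (simp_all add: F_def nat_pow_def mult.commute)
  have "finite (carrier F)" by (simp add: F_def)
  from F.finite_field_mult_group_has_gen[OF this] obtain g where
    "g \<in> carrier (mult_of F)" "carrier (mult_of F) = {g [^]\<^bsub>F\<^esub> i | i :: nat. i \<in> UNIV}" by blast
  moreover have "carrier (mult_of F) = UNIV - {0}" by (auto simp: F_def)
  ultimately have "g \<noteq> 0" "UNIV - {0} = {g ^ i | i. True}" by (auto simp add: pow)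
  thus ?thesis by (intro exI[of _ g]) blast
qed

text \<open>The same integer polynomial gets evaluated at a complex number and at a field element;
  reduction is defined by passing from one value to the other.\<close>

abbreviation ipoly :: "int poly \<Rightarrow> 'b :: comm_ring_1 \<Rightarrow> 'b" where
  "ipoly h x \<equiv> poly (map_poly of_int h) x"

lemma ipoly_pCons [simp]: "ipoly (pCons c h) x = of_int c + x * ipoly h x"
  by (simp add: map_poly_pCons)

lemma ipoly_add [simp]: "ipoly (f + h) x = ipoly f x + ipoly h x"
  by (induction f h rule: poly_induct2) (simp_all add: algebra_simps)

lemma ipoly_diff [simp]: "ipoly (f - h) x = ipoly f x - ipoly h x"
  using ipoly_add[of "f - h" h x] by (simp add: algebra_simps)

lemma ipoly_smult [simp]: "ipoly (smult c h) x = of_int c * ipoly h x"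
  by (induction h) (simp_all add: algebra_simps)

lemma ipoly_mult [simp]: "ipoly (f * h) x = ipoly f x * ipoly h x"
  by (induction f) (simp_all add: algebra_simps)

lemma ipoly_1 [simp]: "ipoly 1 x = 1"
  by (simp add: one_pCons del: poly_1)

lemma ipoly_power [simp]: "ipoly (h ^ k) x = ipoly h x ^ k"
  by (induction k) simp_all

lemma ipoly_sum [simp]: "ipoly (\<Sum>i\<in>A. f i) x = (\<Sum>i\<in>A. ipoly (f i) x)"
  by (induction A rule: infinite_finite_induct) simp_all

lemma prime_elem_root_dvd:
  fixes x :: complex
  assumes f: "prime_elem f" "degree f > 0" "ipoly f x = 0" and h: "ipoly h x = 0"
  shows "f dvd h"
proof -
  \<comment> \<open>Pseudo-division by an integer polynomial \<open>m\<close> of least degree vanishing at \<open>x\<close> replaces Gauss' lemma.\<close>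
  define P where "P = (\<lambda>m :: int poly. m \<noteq> 0 \<and> ipoly m x = 0)"
  have "P f" using f by (auto simp: P_def)
  then obtain m where m: "P m" and least: "\<And>k. P k \<Longrightarrow> degree m \<le> degree k"
    using ex_has_least_nat[of P f degree] by blast
  have m0: "m \<noteq> 0" and mx: "ipoly m x = 0" using m by (simp_all add: P_def)
  have pdiv: "\<exists>c s. c \<noteq> 0 \<and> smult c k = m * s" if "ipoly k x = 0" for k
  proof -
    obtain s r where sr: "pseudo_divmod k m = (s, r)" by force
    obtain c where c: "c \<noteq> 0" "smult c k = m * s + r"
      using pseudo_divmod(1)[OF m0 sr] m0 by (metis leading_coeff_0_iff power_not_zero)
    have "ipoly (smult c k) x = ipoly (m * s + r) x" by (simp only: c)
    hence "ipoly r x = 0" using mx that by simp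
    hence "r = 0" using least[of r] pseudo_divmod(2)[OF m0 sr] by (meson P_def linorder_not_less)
    thus ?thesis using c by auto
  qed
  obtain c s where cs: "c \<noteq> 0" "smult c f = m * s" using pdiv[OF f(3)] by blast
  obtain c' s' where cs': "c' \<noteq> 0" "smult c' h = m * s'" using pdiv[OF h] by blast
  have "f dvd m * s" unfolding cs(2)[symmetric] by (rule dvd_smult) simp
  then consider "f dvd m" | "f dvd s" using f(1) prime_elem_dvd_mult_iff by blast
  thus ?thesis
  proof cases
    case 1
    hence "f dvd [:c':] * h" using cs'(2) by simp
    moreover have "\<not> f dvd [:c':]" using f(2) cs'(1) by (auto dest: dvd_imp_degree_le)
    ultimately show ?thesis using f(1) prime_elem_dvd_mult_iff by blast
  next
    \<comment> \<open>Here \<open>m\<close> divides the nonzero constant \<open>c\<close>, so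
      \<open>c\<close> would vanish at \<open>x\<close>.\<close>
    case 2
    then obtain u where "s = f * u" by blast
    hence "f * [:c:] = f * (m * u)" using cs(2) by (simp add: mult_ac)
    hence "[:c:] = m * u" using f(1) by (metis mult_left_cancel prime_elem_def)
    hence "ipoly [:c:] x = ipoly (m * u) x" by simp
    hence "of_int c = (0 :: complex)" using mx by simp
    thus ?thesis using cs(1) by simp
  qed
qed

lemma exists_prime_elem_root_factor:
  fixes x :: "'a :: idom"
  assumes "h \<noteq> 0" "ipoly h x = 0"
  shows "\<exists>f. prime_elem f \<and> f dvd h \<and> ipoly f x = 0"
  using assms
proof (induction h rule: prime_divisors_induct)
  case (unit h)
  then obtain k where "1 = h * k" by blast
  hence "ipoly 1 x = ipoly (h * k) x" by simp
  thus ?case using unit.prems by simp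
next
  case (factor f h)
  show ?case
  proof (cases "ipoly f x = 0")
    case True
    thus ?thesis using factor.hyps by (intro exI[of _ f]) auto
  next
    case False
    thus ?thesis using factor.prems factor.IH by (auto intro: dvd_mult)
  qed
qed simp

text \<open>\<open>red\<close> is reduction modulo a prime above \<open>p\<close> of a ring of cyclotomic integers containing the
  roots of unity of orders \<open>p\<close> and \<open>q - 1\<close>, and \<open>T\<close> is the Teichmueller lift.\<close>

locale teichmueller =
  fixes R :: "complex set" and red :: "complex \<Rightarrow> 'a :: finite_field" and T :: "'a \<Rightarrow> complex"
  assumes one_in [simp, intro]: "1 \<in> R"
    and diff_in [simp, intro]: "x \<in> R \<Longrightarrow> y \<in> R \<Longrightarrow> x - y \<in> R"
    and mult_in [simp, intro]: "x \<in> R \<Longrightarrow> y \<in> R \<Longrightarrow> x * y \<in> R"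
    and red_1 [simp]: "red 1 = 1"
    and red_diff [simp]: "x \<in> R \<Longrightarrow> y \<in> R \<Longrightarrow> red (x - y) = red x - red y"
    and red_mult [simp]: "x \<in> R \<Longrightarrow> y \<in> R \<Longrightarrow> red (x * y) = red x * red y"
    and T_in [simp, intro]: "T u \<in> R"
    and red_T [simp]: "red (T u) = u"
    and T_mult: "T (u * v) = T u * T v"
    and zeta_in [simp, intro]: "zeta CHAR('a) \<in> R"
    and red_zeta [simp]: "red (zeta CHAR('a)) = 1"

lemma zeta_power: "zeta p ^ k = cis (2 * pi * real k / real p)"
proof -
  have "zeta p = cis (2 * pi / real p)" by (simp add: zeta_def cis_conv_exp mult_ac)
  thus ?thesis by (simp add: DeMoivre mult_ac)
qed

lemma zeta_power_self [simp]: "p > 0 \<Longrightarrow> zeta p ^ p = 1"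
  by (simp add: zeta_power)

text \<open>Write \<open>z\<close> as a power \<open>zeta p ^ c\<close> and invert \<open>c\<close>
  modulo \<open>p\<close>. This puts \<open>zeta p\<close> into the ring generated by a root of
  \<open>Psi\<close>.\<close>

lemma zeta_in_powers:
  assumes p: "prime p" and z: "z ^ p = 1" "z \<noteq> 1"
  shows "\<exists>k. zeta p = z ^ k"
proof -
  have p0: "p > 0" using p by (simp add: prime_gt_0_nat)
  have "z \<in> (\<lambda>k. cis (2 * pi * real k / real p)) ` {..<p}"
    using bij_betw_imp_surj_on[OF bij_betw_roots_unity[OF p0]] z by simp
  then obtain c where c: "c < p" "z = zeta p ^ c" by (auto simp: zeta_power)
  have "c > 0" using c z by (cases c) auto
  hence "coprime c p" using c p by (metis coprime_commute dvd_imp_le linorder_not_less prime_imp_coprime)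
  then obtain k where k: "[c * k = 1] (mod p)" using cong_solve_coprime_nat[of c p] by auto
  have "z ^ k = zeta p ^ (c * k)" by (simp add: c power_mult)
  also have "\<dots> = zeta p ^ (c * k mod p)"
    by (metis div_mult_mod_eq mult_1 p0 power_add power_mult power_one zeta_power_self mult.commute)
  also have "c * k mod p = 1" using k prime_gt_1_nat[OF p] by (simp add: cong_def)
  finally show ?thesis by (intro exI[of _ k]) simp
qed

theorem exists_teichmueller: "\<exists>R (red :: complex \<Rightarrow> 'a :: finite_field) T. teichmueller R red T"
proof -
  define p where "p = CHAR('a)"
  define N where "N = CARD('a) - 1"
  have p: "prime p" by (simp add: p_def)
  have "CARD('a) > 1"
    using card_mono[of UNIV "{0, 1 :: 'a}"] by simp
  hence N: "N > 0" "CARD('a) = N + 1" by (auto simp: N_def)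
  obtain g :: 'a where g0: "g \<noteq> 0" and g: "\<And>x. x \<noteq> 0 \<Longrightarrow> \<exists>i. x = g ^ i"
    using finite_field_has_generator by blast
  have gN: "g ^ N = 1"
    using finite_field_power_card_eq_same[of g] g0 by (simp add: N)
  define X :: "int poly" where "X = [:0, 1:]"
  have X [simp]: "ipoly X x = x" for x :: "'b :: comm_ring_1" by (simp add: X_def)
  \<comment> \<open>\<open>Psi\<close> vanishes at \<open>g\<close> because \<open>g ^ N = 1\<close>, and at a complex \<open>\<eta>\<close> exactly if \<open>\<eta> ^ N\<close> is a primitive
    \<open>p\<close>-th root of unity. An irreducible factor with root \<open>g\<close> makes \<open>\<eta> \<mapsto> g\<close> a ring homomorphism.\<close>
  define Psi where "Psi = (\<Sum>i<p. X ^ (N * i))"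
  have Psi: "ipoly Psi x = (\<Sum>i<p. (x ^ N) ^ i)" for x :: "'b :: comm_ring_1"
    by (simp add: Psi_def power_mult)
  have Psi_0: "ipoly Psi (0 :: complex) = 1"
    using prime_gt_0_nat[OF p] N by (simp add: Psi power_0_left)
  hence Psi0: "Psi \<noteq> 0" by auto
  have "ipoly Psi g = 0" by (simp add: Psi gN p_def)
  then obtain f where f: "prime_elem f" "f dvd Psi" "ipoly f g = 0"
    using exists_prime_elem_root_factor[OF Psi0] by blast
  \<comment> \<open>A constant factor divides the value of \<open>Psi\<close> at \<open>0\<close>,
    which is \<open>1\<close>, and so would be a unit.\<close>
  have deg: "degree f > 0"
  proof (rule ccontr)
    assume "\<not> degree f > 0"
    then obtain c where c: "f = [:c:]" using degree_eq_zeroE by blast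
    obtain k where "Psi = f * k" using f(2) by blast
    hence "ipoly Psi (0 :: complex) = ipoly [:c * poly k 0:] 0"
      using c by (cases k) simp_all
    hence "of_int (c * poly k 0) = (of_int 1 :: complex)" using Psi_0 by simp
    hence "c * poly k 0 = 1" by (simp only: of_int_eq_iff)
    hence "c dvd 1" by (metis dvd_triv_left)
    hence "f dvd 1" using c is_unit_const_poly_iff by blast
    thus False using f(1) by (auto simp: prime_elem_def)
  qed
  have "degree (map_poly of_int f :: complex poly) = degree f" by (rule degree_map_poly) simp
  then obtain \<eta> :: complex where \<eta>: "ipoly f \<eta> = 0"
    using alg_closed_imp_poly_has_root[of "map_poly of_int f :: complex poly"] deg by auto
  define R where "R = range (\<lambda>h. ipoly h \<eta>)"
  \<comment> \<open>The choice of \<open>h\<close> is immaterial: two candidates differ by a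
    multiple of \<open>f\<close>, which vanishes at \<open>g\<close>.\<close>
  define red where "red = (\<lambda>z. ipoly (SOME h. ipoly h \<eta> = z) g)"
  have red: "red (ipoly h \<eta>) = ipoly h g" for h
  proof -
    define h' where "h' = (SOME h'. ipoly h' \<eta> = ipoly h \<eta>)"
    have "ipoly h' \<eta> = ipoly h \<eta>" unfolding h'_def by (rule someI_ex) blast
    hence "f dvd h' - h" by (intro prime_elem_root_dvd[OF f(1) deg \<eta>]) simp
    then obtain k where "h' - h = f * k" by blast
    hence "ipoly (h' - h) g = ipoly (f * k) g" by simp
    hence "ipoly h' g = ipoly h g" using f(3) by simp
    thus ?thesis by (simp add: red_def h'_def)
  qed
  have one: "1 \<in> R" "red 1 = 1"
    using red[of 1] unfolding R_def by (auto intro: range_eqI[of _ _ 1])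
  have diff: "x - y \<in> R" "red (x - y) = red x - red y" if "x \<in> R" "y \<in> R" for x y
    using that unfolding R_def by (auto simp: red simp flip: ipoly_diff)
  have mult: "x * y \<in> R" "red (x * y) = red x * red y" if "x \<in> R" "y \<in> R" for x y
    using that unfolding R_def by (auto simp: red simp flip: ipoly_mult)
  have pow: "\<eta> ^ k \<in> R" "red (\<eta> ^ k) = g ^ k" for k
    using red[of "X ^ k"] unfolding R_def by (auto intro: range_eqI[of _ _ "X ^ k"])
  have sumeta: "(\<Sum>i<p. (\<eta> ^ N) ^ i) = 0"
    using f(2) \<eta> by (auto simp flip: Psi elim!: dvdE)
  have z1: "(\<eta> ^ N) ^ p = 1"
    using sumeta power_diff_1_eq[of "\<eta> ^ N" p] by simp
  have z2: "\<eta> ^ N \<noteq> 1" using sumeta prime_gt_0_nat[OF p] by auto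
  obtain k where k: "zeta p = \<eta> ^ (N * k)" using zeta_in_powers[OF p z1 z2] by (auto simp: power_mult)
  \<comment> \<open>The power \<open>CARD('a)\<close> removes the \<open>p\<close>-part of \<eta>,
    leaving an \<open>N\<close>-th root of unity, and the reduction is still
    \<open>g\<close>.\<close>
  define \<omega> where "\<omega> = \<eta> ^ CARD('a)"
  have "p dvd CARD('a)" unfolding p_def by (rule CHAR_dvd_CARD)
  hence \<omega>N: "\<omega> ^ N = 1"
    unfolding \<omega>_def by (metis dvdE mult.commute power_mult power_one z1)
  have \<omega>: "\<omega> ^ i \<in> R" "red (\<omega> ^ i) = g ^ i" for i
    using pow[of "CARD('a) * i"] by (simp_all add: \<omega>_def power_mult finite_field_power_card_eq_same)
  \<comment> \<open>An \<open>N\<close>-th root of unity other than \<open>1\<close> has vanishing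
    geometric sum; but if it reduces to \<open>1\<close>, the sum reduces to \<open>N\<close>, which
    is \<open>- 1\<close> in the field.\<close>
  have root: "\<omega> ^ i = 1" if "g ^ i = 1" for i
  proof (rule ccontr)
    assume neq: "\<omega> ^ i \<noteq> 1"
    have "(\<omega> ^ i) ^ N = 1" by (metis \<omega>N mult.commute power_mult power_one)
    hence "(\<Sum>j<N. (\<omega> ^ i) ^ j) = 0" using power_diff_1_eq[of "\<omega> ^ i" N] neq by simp
    moreover have "(\<Sum>j<N. (\<omega> ^ i) ^ j) = ipoly (\<Sum>j<N. X ^ (CARD('a) * i * j)) \<eta>"
      by (simp add: \<omega>_def power_mult)
    ultimately have "ipoly (\<Sum>j<N. X ^ (CARD('a) * i * j)) g = 0"
      using red[of "\<Sum>j<N. X ^ (CARD('a) * i * j)"] red[of 0] by simp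
    hence "of_nat N = (0 :: 'a)"
      using that by (simp add: power_mult finite_field_power_card_eq_same)
    moreover have "of_nat CARD('a) = (0 :: 'a)"
      using CHAR_dvd_CARD of_nat_eq_0_iff_char_dvd by blast
    ultimately show False by (simp add: N)
  qed
  have inj: "\<omega> ^ i = \<omega> ^ j" if "g ^ i = g ^ j" for i j
    using that
  proof (induction i j rule: linorder_wlog)
    case (le i j)
    hence "g ^ i * g ^ (j - i) = g ^ (i + (j - i))" by (simp only: power_add)
    also have "\<dots> = g ^ i" using le by simp
    finally have "g ^ i * g ^ (j - i) = g ^ i" .
    hence "\<omega> ^ (j - i) = 1" using g0 by (intro root) simp
    thus ?case using le(1) power_add[of \<omega> i "j - i"] by simp
  qed simp
  \<comment> \<open>The value \<open>0\<close> at \<open>0\<close> keeps \<open>T\<close>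
    multiplicative and compatible with \<open>red\<close>.\<close>
  define T where "T = (\<lambda>x :: 'a. if x = 0 then 0 else \<omega> ^ (SOME i. x = g ^ i))"
  have T: "T (g ^ i) = \<omega> ^ i" for i
  proof -
    have "g ^ i = g ^ (SOME j. g ^ i = g ^ j)" by (rule someI_ex) blast
    from inj[OF this] show ?thesis using g0 by (simp add: T_def)
  qed
  have "teichmueller R red T"
  proof
    show "T u \<in> R" for u
      using g[of u] diff(1)[OF one(1) one(1)] by (cases "u = 0") (auto simp: T \<omega>, simp add: T_def)
    show "red (T u) = u" for u
      using g[of u] diff(2)[OF one(1) one(1)] by (cases "u = 0") (auto simp: T \<omega>, simp add: T_def)
    show "T (u * v) = T u * T v" for u v
    proof (cases "u = 0 \<or> v = 0")
      case False
      then obtain i j where "u = g ^ i" "v = g ^ j" using g by blast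
      thus ?thesis by (simp add: T flip: power_add)
    qed (auto simp: T_def)
    show "zeta CHAR('a) \<in> R" using pow k by (simp add: p_def)
    show "red (zeta CHAR('a)) = 1"
      using pow(2)[of "N * k"] gN unfolding k[symmetric] by (simp add: p_def power_mult)
  qed (use one diff mult in auto)
  thus ?thesis by blast
qed

section \<open>Gauss sums and Weil sums\<close>

lemma ff_degree_eq:
  assumes "CARD('a :: finite_field) = CHAR('a) ^ n"
  shows "ff_degree TYPE('a) = n"
  unfolding ff_degree_def
proof (rule the_equality)
  fix m assume "CARD('a) = CHAR('a) ^ m"
  moreover have "CHAR('a) > 1" using prime_gt_1_nat[OF CHAR_prime] by blast
  ultimately show "m = n" using assms by (metis power_inject_exp)
qed fact

lemma abs_trace_add: "abs_trace (x + y :: 'a :: finite_field) = abs_trace x + abs_trace y"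
  unfolding abs_trace_def sum.distrib[symmetric]
  by (intro sum.cong refl freshmans_dream') auto

lemma sum_shift_frobenius:
  fixes x :: "'a :: finite_field"
  assumes "CARD('a) = CHAR('a) ^ n"
  shows "(\<Sum>i<n. x ^ (CHAR('a) ^ Suc i)) = (\<Sum>i<n. x ^ (CHAR('a) ^ i))"
proof -
  have "(\<Sum>i<Suc n. x ^ (CHAR('a) ^ i)) = x + (\<Sum>i<n. x ^ (CHAR('a) ^ Suc i))"
    unfolding sum.lessThan_Suc_shift by simp
  moreover have "x ^ (CHAR('a) ^ n) = x" using finite_field_power_card_eq_same[of x] assms by simp
  ultimately show ?thesis by simp
qed

lemma abs_trace_frobenius:
  fixes x :: "'a :: finite_field"
  assumes "CARD('a) = CHAR('a) ^ n"
  shows "abs_trace (x ^ CHAR('a)) = abs_trace x" "abs_trace x ^ CHAR('a) = abs_trace x"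
proof -
  show "abs_trace (x ^ CHAR('a)) = abs_trace x"
    using sum_shift_frobenius[OF assms, of x]
    by (simp add: abs_trace_def ff_degree_eq[OF assms] flip: power_mult)
  have "abs_trace x ^ CHAR('a) = (\<Sum>i<n. (x ^ (CHAR('a) ^ i)) ^ CHAR('a))"
    unfolding abs_trace_def ff_degree_eq[OF assms] by (rule freshmans_dream_sum) auto
  also have "\<dots> = abs_trace x"
    using sum_shift_frobenius[OF assms, of x]
    by (simp add: abs_trace_def ff_degree_eq[OF assms] mult.commute flip: power_mult)
  finally show "abs_trace x ^ CHAR('a) = abs_trace x" .
qed

lemma of_nat_eq_iff_mod_CHAR:
  "(of_nat a :: 'a :: finite_field) = of_nat b \<longleftrightarrow> a mod CHAR('a) = b mod CHAR('a)"
  using of_nat_eq_iff_cong_CHAR[of a b, where ?'a = 'a] by (simp add: cong_def)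

text \<open>Elements fixed by Frobenius are roots of \<open>X^p - X\<close>. The \<open>p\<close>
  distinct images of \<open>0, ..., p - 1\<close> are roots already, so the degree leaves room for
  no others.\<close>

lemma prime_field_rep:
  fixes y :: "'a :: finite_field"
  assumes "y ^ CHAR('a) = y"
  shows "prime_field_rep y < CHAR('a)" "of_nat (prime_field_rep y) = y"
proof -
  define p where "p = CHAR('a)"
  have p: "prime p" by (simp add: p_def)
  define f :: "'a poly" where "f = Polynomial.monom 1 p - [:0, 1:]"
  have f: "poly f x = x ^ p - x" for x by (simp add: f_def poly_monom)
  have deg: "degree f \<le> p"
    unfolding f_def using prime_gt_1_nat[OF p] by (intro degree_diff_le) (auto simp: degree_monom_eq)
  have "Polynomial.coeff f p = 1"
    using prime_gt_1_nat[OF p] by (simp add: f_def coeff_eq_0)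
  hence f0: "f \<noteq> 0" by auto
  have inj: "inj_on (of_nat :: nat \<Rightarrow> 'a) {..<p}"
    by (auto simp: inj_on_def of_nat_eq_iff_mod_CHAR p_def)
  have frob: "(of_nat k :: 'a) ^ p = of_nat k" for k
  proof (induction k)
    case (Suc k)
    have "(of_nat k + 1 :: 'a) ^ p = of_nat k ^ p + 1 ^ p"
      by (rule freshmans_dream) (auto simp: p_def)
    thus ?case using Suc by (simp add: add.commute)
  qed (use prime_gt_0_nat[OF p] in simp)
  have "of_nat ` {..<p} = {x. poly f x = 0}"
  proof (rule card_subset_eq)
    show "finite {x. poly f x = 0}" by simp
    show sub: "of_nat ` {..<p} \<subseteq> {x. poly f x = 0}" by (auto simp: f frob)
    have "card {x. poly f x = 0} \<le> p" using card_poly_roots_bound[OF f0] deg by linarith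
    moreover have "card (of_nat ` {..<p} :: 'a set) = p" using card_image[OF inj] by simp
    ultimately show "card (of_nat ` {..<p} :: 'a set) = card {x. poly f x = 0}"
      using card_mono[OF _ sub] by simp
  qed
  moreover have "poly f y = 0" using assms by (simp add: f p_def)
  ultimately obtain k where k: "k < p" "y = of_nat k" by auto
  have "prime_field_rep y = k"
    unfolding prime_field_rep_def
  proof (rule the_equality)
    show "k < CHAR('a) \<and> of_nat k = y" using k by (simp add: p_def)
    show "j = k" if "j < CHAR('a) \<and> of_nat j = y" for j
      using that k inj by (auto simp: p_def inj_on_def)
  qed
  thus "prime_field_rep y < CHAR('a)" "of_nat (prime_field_rep y) = y" using k by (auto simp: p_def)
qed

definition trace_rep :: "'a :: finite_field \<Rightarrow> nat" where
  "trace_rep x = prime_field_rep (abs_trace x)"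

lemma canonical_char_eq: "canonical_char (x :: 'a :: finite_field) = zeta CHAR('a) ^ trace_rep x"
  by (simp add: canonical_char_def zeta_def trace_rep_def mult_ac flip: exp_of_nat_mult)

lemma zeta_power_cong:
  assumes "a mod p = b mod p" "p > 0"
  shows "zeta p ^ a = zeta p ^ b"
proof -
  have "zeta p ^ a = zeta p ^ (a mod p)" for a
    using assms(2) by (metis div_mult_mod_eq mult_1 power_add power_mult power_one zeta_power_self mult.commute)
  thus ?thesis using assms(1) by metis
qed

section \<open>Working rules for the character, \<open>R\<close>, \<open>red\<close> and
  \<open>T\<close>\<close>

locale gauss_sums = teichmueller R red T
  for R and red :: "complex \<Rightarrow> 'a :: finite_field" and T +
  fixes p q n :: nat
  assumes char_eq: "CHAR('a) = p" and card_eq: "CARD('a) = q" and q_eq: "q = p ^ n"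
begin

abbreviation \<psi> :: "'a \<Rightarrow> complex" where "\<psi> \<equiv> canonical_char"
abbreviation \<pi> :: complex where "\<pi> \<equiv> 1 - zeta p"

lemma card_eq_power: "CARD('a) = CHAR('a) ^ n"
  by (simp add: char_eq card_eq q_eq)

lemma prime_p: "prime p"
  using CHAR_prime[where ?'a = 'a] by (simp add: char_eq)

lemmas zeta_p_in [simp, intro] = zeta_in[unfolded char_eq]
lemmas red_zeta_p [simp] = red_zeta[unfolded char_eq]
lemmas char_eq_zeta = canonical_char_eq[where ?'a = 'a, unfolded char_eq]

lemma of_nat_trace_rep: "of_nat (trace_rep x) = (abs_trace x :: 'a)"
  unfolding trace_rep_def by (intro prime_field_rep abs_trace_frobenius[OF card_eq_power])

lemma char_add: "\<psi> (x + y) = \<psi> x * \<psi> y"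
proof -
  have "of_nat (trace_rep (x + y)) = (of_nat (trace_rep x + trace_rep y) :: 'a)"
    by (simp add: of_nat_trace_rep abs_trace_add)
  hence "trace_rep (x + y) mod p = (trace_rep x + trace_rep y) mod p"
    unfolding of_nat_eq_iff_mod_CHAR char_eq .
  thus ?thesis
    unfolding char_eq_zeta power_add[symmetric]
    by (intro zeta_power_cong) (use prime_gt_0_nat[OF prime_p] in auto)
qed

lemma char_frobenius: "\<psi> (x ^ p) = \<psi> x"
  by (simp add: char_eq_zeta trace_rep_def abs_trace_frobenius[OF card_eq_power, unfolded char_eq])

lemma zero_in [simp, intro]: "0 \<in> R" and red_0 [simp]: "red 0 = 0"
  using diff_in[OF one_in one_in] red_diff[OF one_in one_in] by simp_all

lemma uminus_in [simp, intro]: "x \<in> R \<Longrightarrow> - x \<in> R"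
  and red_uminus [simp]: "x \<in> R \<Longrightarrow> red (- x) = - red x"
  using diff_in[OF zero_in, of x] red_diff[OF zero_in, of x] by simp_all

lemma add_in [simp, intro]: "x \<in> R \<Longrightarrow> y \<in> R \<Longrightarrow> x + y \<in> R"
  and red_add [simp]: "x \<in> R \<Longrightarrow> y \<in> R \<Longrightarrow> red (x + y) = red x + red y"
  using diff_in[of x "- y"] red_diff[of x "- y"] by simp_all

lemma power_in [simp, intro]: "x \<in> R \<Longrightarrow> x ^ k \<in> R"
  by (induction k) simp_all

lemma red_power [simp]: "x \<in> R \<Longrightarrow> red (x ^ k) = red x ^ k"
  by (induction k) simp_all

lemma sum_in [simp, intro]: "(\<And>i. i \<in> A \<Longrightarrow> f i \<in> R) \<Longrightarrow> sum f A \<in> R"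
  by (induction A rule: infinite_finite_induct) simp_all

lemma red_sum: "(\<And>i. i \<in> A \<Longrightarrow> f i \<in> R) \<Longrightarrow> red (sum f A) = (\<Sum>i\<in>A. red (f i))"
  by (induction A rule: infinite_finite_induct) simp_all

lemma T_0 [simp]: "T 0 = 0"
  using T_mult[of 0 0] red_T[of 0] red_1 by (metis mult_cancel_right2 mult_zero_left zero_neq_one)

lemma T_1 [simp]: "T 1 = 1"
  using T_mult[of 1 1] red_T[of 1] red_0 by (metis mult_cancel_right2 mult_1_left zero_neq_one)

lemma T_power: "T (x ^ k) = T x ^ k"
  by (induction k) (simp_all add: T_mult)

lemma char_in [simp, intro]: "\<psi> x \<in> R" and red_char [simp]: "red (\<psi> x) = 1"
  by (simp_all add: char_eq_zeta)

lemma q_gt_1: "q > 1"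
  using card_mono[of UNIV "{0, 1 :: 'a}"] by (simp add: card_eq)

section \<open>Power sums and orthogonality of multiplicative characters\<close>

lemma fermat: "x \<noteq> 0 \<Longrightarrow> x ^ (q - 1) = (1 :: 'a)"
proof -
  assume x: "x \<noteq> 0"
  have "x * x ^ (q - 1) = x ^ q" using q_gt_1 by (simp flip: power_Suc)
  also have "\<dots> = x * 1" using finite_field_power_card_eq_same[of x] by (simp add: card_eq)
  finally show ?thesis using x by simp
qed

lemma power_mod_fermat:
  assumes "x \<noteq> 0" shows "x ^ k = (x :: 'a) ^ (k mod (q - 1))"
proof -
  have "x ^ k = x ^ ((q - 1) * (k div (q - 1)) + k mod (q - 1))" by simp
  also have "\<dots> = x ^ (k mod (q - 1))"
    unfolding power_add power_mult fermat[OF assms] by simp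
  finally show ?thesis .
qed

text \<open>Otherwise \<open>X^r - 1\<close> with \<open>0 < r < q - 1\<close> would have all
  \<open>q - 1\<close> nonzero elements as roots.\<close>

lemma exists_power_ne_1:
  assumes "\<not> (q - 1) dvd k"
  shows "\<exists>u :: 'a. u \<noteq> 0 \<and> u ^ k \<noteq> 1"
proof (rule ccontr)
  assume "\<not> ?thesis"
  hence all: "u ^ k = 1" if "u \<noteq> 0" for u :: 'a using that by blast
  define r where "r = k mod (q - 1)"
  have r: "0 < r" "r < q - 1" using assms q_gt_1 by (auto simp: r_def dvd_eq_mod_eq_0)
  define f :: "'a poly" where "f = Polynomial.monom 1 r - 1"
  have "Polynomial.coeff f r = 1" using r by (simp add: f_def)
  hence f0: "f \<noteq> 0" by auto
  have "degree f \<le> r" unfolding f_def by (intro degree_diff_le) (auto simp: degree_monom_eq)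
  hence "card {x. poly f x = 0} \<le> r" using card_poly_roots_bound[OF f0] by linarith
  moreover have "UNIV - {0} \<subseteq> {x. poly f x = 0}"
    using all power_mod_fermat[of _ k] by (auto simp: f_def poly_monom r_def)
  hence "card (UNIV - {0 :: 'a}) \<le> card {x. poly f x = 0}" by (intro card_mono) auto
  hence "q - 1 \<le> card {x. poly f x = 0}" by (simp add: card_Diff_subset card_eq)
  ultimately show False using r by linarith
qed

lemma of_nat_q: "of_nat q = (0 :: 'a)"
  unfolding card_eq[symmetric] using CHAR_dvd_CARD of_nat_eq_0_iff_char_dvd by blast

lemma sum_powers_eq_0:
  assumes "\<not> (q - 1) dvd k"
  shows "(\<Sum>x\<in>UNIV - {0 :: 'a}. x ^ k) = 0"
proof -
  obtain u :: 'a where u: "u \<noteq> 0" "u ^ k \<noteq> 1" using exists_power_ne_1[OF assms] by blast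
  have "(\<Sum>x\<in>UNIV - {0 :: 'a}. x ^ k) = (\<Sum>x\<in>UNIV - {0}. (u * x) ^ k)"
    by (rule sum.reindex_bij_witness[of _ "\<lambda>x. u * x" "\<lambda>x. x / u"]) (use u in auto)
  also have "\<dots> = u ^ k * (\<Sum>x\<in>UNIV - {0 :: 'a}. x ^ k)"
    by (simp add: power_mult_distrib sum_distrib_left)
  finally show ?thesis using u by (metis mult_cancel_right2)
qed

lemma sum_T_eq_0:
  assumes "\<not> (q - 1) dvd k"
  shows "(\<Sum>x\<in>UNIV - {0}. T (inverse x) ^ k) = 0"
proof -
  obtain u :: 'a where u: "u \<noteq> 0" "u ^ k \<noteq> 1" using exists_power_ne_1[OF assms] by blast
  hence T: "T u ^ k \<noteq> 1" using red_T[of "u ^ k"] red_1 by (metis T_power)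
  have "(\<Sum>x\<in>UNIV - {0}. T (inverse x) ^ k) = (\<Sum>x\<in>UNIV - {0}. T (u * inverse x) ^ k)"
    by (rule sum.reindex_bij_witness[of _ "\<lambda>x. x / u" "\<lambda>x. u * x"]) (use u in \<open>auto simp: field_simps\<close>)
  also have "\<dots> = T u ^ k * (\<Sum>x\<in>UNIV - {0}. T (inverse x) ^ k)"
    by (simp add: T_mult power_mult_distrib sum_distrib_left)
  finally show ?thesis using T by (metis mult_cancel_right2)
qed

section \<open>Gauss sums and local divisibility\<close>

text \<open>The Gauss sum of the character \<open>T\<^sup>-\<^sup>a\<close>; its \<open>(1 - zeta p)\<close>-adic valuation is the base-\<open>p\<close> digit
  sum of \<open>a\<close>, but only the upper bound is needed.\<close>

definition gauss :: "nat \<Rightarrow> complex" where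
  "gauss a = (\<Sum>x\<in>UNIV - {0}. T (inverse x) ^ a * \<psi> x)"

lemma gauss_in [simp, intro]: "gauss a \<in> R"
  unfolding gauss_def by (intro sum_in mult_in power_in T_in char_in)

text \<open>\<open>ldvd x y\<close> is divisibility in the localisation of \<open>R\<close> at the kernel of \<open>red\<close>.\<close>

definition ldvd :: "complex \<Rightarrow> complex \<Rightarrow> bool" where
  "ldvd x y \<longleftrightarrow> (\<exists>u r. u \<in> R \<and> r \<in> R \<and> red u \<noteq> 0 \<and> u * y = r * x)"

lemma ldvdI: "u \<in> R \<Longrightarrow> r \<in> R \<Longrightarrow> red u \<noteq> 0 \<Longrightarrow> u * y = r * x \<Longrightarrow> ldvd x y"
  unfolding ldvd_def by blast

lemma ldvd_mult:
  assumes "ldvd x y" "ldvd x' y'"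
  shows "ldvd (x * x') (y * y')"
proof -
  obtain u r u' r' where *: "u \<in> R" "r \<in> R" "red u \<noteq> 0" "u * y = r * x"
    "u' \<in> R" "r' \<in> R" "red u' \<noteq> 0" "u' * y' = r' * x'"
    using assms unfolding ldvd_def by blast
  show ?thesis
  proof (rule ldvdI)
    have "u * u' * (y * y') = (u * y) * (u' * y')" by simp
    thus "u * u' * (y * y') = r * r' * (x * x')" by (simp add: *)
  qed (use * in auto)
qed

lemma ldvd_trans:
  assumes "ldvd x y" "ldvd y z"
  shows "ldvd x z"
proof -
  obtain u r u' r' where *: "u \<in> R" "r \<in> R" "red u \<noteq> 0" "u * y = r * x"
    "u' \<in> R" "r' \<in> R" "red u' \<noteq> 0" "u' * z = r' * y"
    using assms unfolding ldvd_def by blast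
  show ?thesis
  proof (rule ldvdI)
    have "u * u' * z = u * (u' * z)" by simp
    also have "\<dots> = r' * (u * y)" unfolding *(8) by simp
    finally show "u * u' * z = r' * r * x" by (simp add: *)
  qed (use * in auto)
qed

text \<open>For the trivial character every summand reduces to \<open>1\<close>, giving
  \<open>q - 1\<close> in the field. Hence such a Gauss sum is a local unit.\<close>

lemma red_gauss_trivial:
  assumes "(q - 1) dvd a"
  shows "red (gauss a) = - 1"
proof -
  have "red (gauss a) = (\<Sum>x\<in>UNIV - {0}. inverse x ^ a)"
    unfolding gauss_def by (subst red_sum) auto
  also have "\<dots> = (\<Sum>x\<in>UNIV - {0 :: 'a}. 1)"
    using assms by (intro sum.cong) (auto elim!: dvdE simp: power_mult fermat[unfolded One_nat_def])
  also have "\<dots> = of_nat q - 1" using q_gt_1 by (simp add: card_Diff_subset card_eq of_nat_diff)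
  finally show ?thesis by (simp add: of_nat_q)
qed

text \<open>If \<open>T^-(a + b)\<close> is trivial, the divisor is a local unit. Otherwise collect
  the product by \<open>t = x + y\<close>: the part \<open>t = 0\<close> vanishes by orthogonality,
  and for other \<open>t\<close> the scaling \<open>x = t * y\<close> splits off the Jacobi sum
  \<open>J\<close>.\<close>

lemma gauss_add_ldvd: "ldvd (gauss (a + b)) (gauss a * gauss b)"
proof (cases "(q - 1) dvd a + b")
  case True
  thus ?thesis
    by (intro ldvdI[of "gauss (a + b)" "gauss a * gauss b"]) (auto simp: red_gauss_trivial)
next
  case False
  define U where "U = (UNIV :: 'a set) - {0}"
  define J where "J = (\<Sum>x\<in>U - {1}. T (inverse x) ^ a * T (inverse (1 - x)) ^ b)"
  have J: "J \<in> R" unfolding J_def by auto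
  have fin: "finite U" by (simp add: U_def)
  define f where "f = (\<lambda>x t. T (inverse x) ^ a * T (inverse (t - x)) ^ b * \<psi> t)"
  have "gauss a * gauss b =
      (\<Sum>x\<in>U. \<Sum>y\<in>U. T (inverse x) ^ a * T (inverse y) ^ b * \<psi> (x + y))"
    unfolding gauss_def U_def by (simp add: sum_product char_add mult_ac)
  also have "\<dots> = (\<Sum>x\<in>U. \<Sum>t\<in>UNIV - {x}. f x t)"
    unfolding f_def
    by (intro sum.cong refl sum.reindex_bij_witness[of _ "\<lambda>t. t - x" "\<lambda>y. x + y" for x])
      (auto simp: U_def)
  also have "\<dots> = (\<Sum>x\<in>U. f x 0 + (\<Sum>t\<in>U - {x}. f x t))"
  proof (intro sum.cong refl)
    fix x assume x: "x \<in> U"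
    have "UNIV - {x} = insert 0 (U - {x})" using x by (auto simp: U_def)
    thus "(\<Sum>t\<in>UNIV - {x}. f x t) = f x 0 + (\<Sum>t\<in>U - {x}. f x t)"
      using fin by (simp add: U_def)
  qed
  also have "\<dots> = (\<Sum>x\<in>U. f x 0) + (\<Sum>x\<in>U. \<Sum>t\<in>U - {x}. f x t)"
    by (simp add: sum.distrib)
  also have "(\<Sum>x\<in>U. f x 0) = (\<Sum>x\<in>U. T (- 1) ^ b * \<psi> 0 * T (inverse x) ^ (a + b))"
  proof (intro sum.cong refl)
    fix x
    have "T (inverse (0 - x)) = T (- 1) * T (inverse x)"
      using T_mult[of "- 1" "inverse x"] by simp
    thus "f x 0 = T (- 1) ^ b * \<psi> 0 * T (inverse x) ^ (a + b)"
      by (simp add: f_def power_mult_distrib power_add mult_ac)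
  qed
  also have "\<dots> = 0"
    using sum_T_eq_0[OF False] by (simp add: U_def flip: sum_distrib_left)
  also have "(\<Sum>x\<in>U. \<Sum>t\<in>U - {x}. f x t) = (\<Sum>t\<in>U. \<Sum>x\<in>U - {t}. f x t)"
    by (rule sum.swap_restrict[OF fin fin, of _ "\<lambda>x t. t \<noteq> x", THEN trans[rotated], THEN trans])
      (auto intro!: sum.cong)
  also have "\<dots> = (\<Sum>t\<in>U. T (inverse t) ^ (a + b) * \<psi> t * J)"
  proof (intro sum.cong refl)
    fix t assume t: "t \<in> U"
    have "(\<Sum>x\<in>U - {t}. f x t) = (\<Sum>y\<in>U - {1}. f (t * y) t)"
      by (rule sum.reindex_bij_witness[of _ "\<lambda>y. t * y" "\<lambda>x. x / t"])
        (use t in \<open>auto simp: U_def\<close>)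
    also have "\<dots> = (\<Sum>y\<in>U - {1}. T (inverse t) ^ (a + b) * \<psi> t *
        (T (inverse y) ^ a * T (inverse (1 - y)) ^ b))"
    proof (intro sum.cong refl)
      fix y
      have "inverse (t - t * y) = inverse t * inverse (1 - y)"
        by (metis inverse_mult_distrib mult.right_neutral right_diff_distrib)
      thus "f (t * y) t = T (inverse t) ^ (a + b) * \<psi> t *
          (T (inverse y) ^ a * T (inverse (1 - y)) ^ b)"
        by (simp add: f_def T_mult power_mult_distrib power_add mult_ac)
    qed
    finally show "(\<Sum>x\<in>U - {t}. f x t) = T (inverse t) ^ (a + b) * \<psi> t * J"
      by (simp add: J_def sum_distrib_left)
  qed
  also have "\<dots> = J * gauss (a + b)"
    by (simp add: gauss_def U_def sum_distrib_left sum_distrib_right mult_ac)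
  finally show ?thesis using J by (intro ldvdI[of 1 J]) auto
qed

lemma bij_power_coprime:
  assumes "coprime d (q - 1)" "d > 0"
  shows "bij (\<lambda>x :: 'a. x ^ d)"
proof -
  have "inj (\<lambda>x :: 'a. x ^ d)"
  proof (rule injI)
    fix x y :: 'a assume eq: "x ^ d = y ^ d"
    show "x = y"
    proof (cases "x = 0 \<or> y = 0")
      case True
      thus ?thesis using eq assms(2) by (auto simp: power_0_left)
    next
      case False
      obtain e where e: "[d * e = 1] (mod (q - 1))"
        using cong_solve_coprime_nat[OF assms(1)] by auto
      have "z ^ (d * e) = z" if "z \<noteq> 0" for z :: 'a
        using e power_mod_fermat[OF that, of "d * e"] power_mod_fermat[OF that, of 1]
        by (simp add: cong_def)
      thus ?thesis using False eq by (metis power_mult)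
    qed
  qed
  thus ?thesis by (simp add: bij_def finite_UNIV_inj_surj)
qed

lemma sum_power_reindex:
  assumes "coprime d (q - 1)" "d > 0"
  shows "(\<Sum>x\<in>UNIV - {0 :: 'a}. f (x ^ d)) = (\<Sum>x\<in>UNIV - {0}. f x)"
proof (rule sum.reindex_bij_betw)
  have "bij_betw (\<lambda>x :: 'a. x ^ d) (UNIV - {0}) ((\<lambda>x. x ^ d) ` (UNIV - {0}))"
    using bij_power_coprime[OF assms] by (meson bij_betw_subset subset_UNIV)
  moreover have "(\<lambda>x :: 'a. x ^ d) ` (UNIV - {0}) = UNIV - {0}"
    using bij_power_coprime[OF assms] assms(2) by (simp add: image_set_diff bij_is_inj bij_is_surj power_0_left)
  ultimately show "bij_betw (\<lambda>x :: 'a. x ^ d) (UNIV - {0}) (UNIV - {0})" by simp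
qed

lemma n_pos: "n > 0"
  using q_gt_1 q_eq by (cases n) auto

text \<open>Substitute the Frobenius image of \<open>x\<close>: it permutes the nonzero elements and
  preserves \<psi>.\<close>

lemma gauss_frobenius: "gauss (p * a) = gauss a"
proof -
  have "coprime p (q - 1)"
  proof -
    have "coprime q (q - 1)" using q_gt_1
      by (metis coprime_diff_one_left_nat coprime_commute gr_implies_not0 bot_nat_0.not_eq_extremum)
    moreover have "p dvd q" using q_eq n_pos by simp
    ultimately show ?thesis using coprime_divisors dvd_refl by blast
  qed
  from sum_power_reindex[OF this prime_gt_0_nat[OF prime_p], of "\<lambda>x. T (inverse x) ^ a * \<psi> x"]
  show ?thesis
    by (simp add: gauss_def char_frobenius power_mult T_power flip: power_inverse)
qed

lemma gauss_frobenius_power: "gauss (p ^ i * a) = gauss a"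
  by (induction i) (simp_all add: gauss_frobenius mult.assoc)

lemma pi_nonzero: "\<pi> \<noteq> 0"
proof
  assume "\<pi> = 0"
  hence "cis (2 * pi / real p) = 1" using zeta_power[of p 1] by simp
  hence "(\<lambda>k. cis (2 * pi * real k / real p)) 1 = (\<lambda>k. cis (2 * pi * real k / real p)) 0" by simp
  moreover have "inj_on (\<lambda>k. cis (2 * pi * real k / real p)) {..<p}"
    using bij_betw_roots_unity[OF prime_gt_0_nat[OF prime_p]] bij_betw_imp_inj_on by blast
  ultimately have "(1 :: nat) = 0"
    using prime_gt_1_nat[OF prime_p] prime_gt_0_nat[OF prime_p] by (metis inj_onD lessThan_iff)
  thus False by simp
qed

text \<open>Expanding the trace gives power sums with exponents \<open>p ^ i - 1\<close>; only
  \<open>i = 0\<close> survives, contributing \<open>q - 1\<close>. The result is the leading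
  coefficient of \<open>gauss 1\<close> in \<pi>, up to sign.\<close>

lemma sum_inverse_trace: "(\<Sum>x\<in>UNIV - {0 :: 'a}. inverse x * abs_trace x) = - 1"
proof -
  have "(\<Sum>x\<in>UNIV - {0 :: 'a}. inverse x * abs_trace x)
      = (\<Sum>x\<in>UNIV - {0 :: 'a}. \<Sum>i<n. x ^ (p ^ i - 1))"
  proof (intro sum.cong refl)
    fix x :: 'a assume x: "x \<in> UNIV - {0}"
    have "inverse x * x ^ (p ^ i) = x ^ (p ^ i - 1)" for i
      using x prime_gt_0_nat[OF prime_p] power_minus_mult[of "p ^ i" x] by (simp add: field_simps)
    thus "inverse x * abs_trace x = (\<Sum>i<n. x ^ (p ^ i - 1))"
      by (simp add: abs_trace_def ff_degree_eq[OF card_eq_power] sum_distrib_left char_eq)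
  qed
  also have "\<dots> = (\<Sum>i<n. \<Sum>x\<in>UNIV - {0 :: 'a}. x ^ (p ^ i - 1))" by (rule sum.swap)
  also have "\<dots> = (\<Sum>i\<in>{0}. \<Sum>x\<in>UNIV - {0 :: 'a}. x ^ (p ^ i - 1))"
  proof (rule sum.mono_neutral_right)
    show "\<forall>i\<in>{..<n} - {0}. (\<Sum>x\<in>UNIV - {0 :: 'a}. x ^ (p ^ i - 1)) = 0"
    proof
      fix i assume i: "i \<in> {..<n} - {0}"
      have "p ^ i < q" using i q_eq prime_gt_1_nat[OF prime_p] by simp
      moreover have "p ^ i > 1" using i prime_gt_1_nat[OF prime_p] by (intro one_less_power) auto
      ultimately have "\<not> (q - 1) dvd p ^ i - 1" by (auto dest!: dvd_imp_le)
      thus "(\<Sum>x\<in>UNIV - {0 :: 'a}. x ^ (p ^ i - 1)) = 0" by (rule sum_powers_eq_0)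
    qed
  qed (use n_pos in auto)
  also have "\<dots> = - 1" using q_gt_1 by (simp add: card_Diff_subset card_eq of_nat_diff of_nat_q)
  finally show ?thesis .
qed

text \<open>Expand \<psi> to first order, \<open>1 - \<pi> * E x\<close> with \<open>E x\<close>
  reducing to the trace. The constant terms cancel since \<open>q > 2\<close> makes the character
  nontrivial, and the cofactor of \<pi> is a local unit.\<close>

lemma gauss_1_ldvd:
  assumes "q > 2"
  shows "ldvd (gauss 1) \<pi>"
proof -
  define E where "E = (\<lambda>x :: 'a. \<Sum>j<trace_rep x. zeta p ^ j)"
  have E: "E x \<in> R" "red (E x) = abs_trace x" for x
    by (auto simp: E_def red_sum of_nat_trace_rep)
  have char: "\<psi> x = 1 - \<pi> * E x" for x
    using power_diff_1_eq[of "zeta p" "trace_rep x"] by (simp add: E_def char_eq_zeta algebra_simps)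
  define S where "S = (\<Sum>x\<in>UNIV - {0}. T (inverse x) * E x)"
  have S: "S \<in> R" unfolding S_def using E by auto
  have "\<not> (q - 1) dvd 1" using assms by simp
  hence "(\<Sum>x\<in>UNIV - {0}. T (inverse x)) = 0" using sum_T_eq_0[of 1] by simp
  moreover have "gauss 1 = (\<Sum>x\<in>UNIV - {0}. T (inverse x) - \<pi> * (T (inverse x) * E x))"
    unfolding gauss_def char by (intro sum.cong refl)
      (simp only: power_one_right right_diff_distrib mult_1_right mult.left_commute)
  ultimately have "gauss 1 = - S * \<pi>"
    by (simp add: S_def sum_subtractf mult.commute flip: sum_distrib_left)
  moreover have "red S = - 1"
    using E unfolding S_def by (subst red_sum) (auto simp: sum_inverse_trace)
  ultimately show ?thesis using S by (intro ldvdI[of "- S" 1]) auto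
qed

lemma gauss_0_ldvd: "ldvd (gauss 0) 1"
  by (rule ldvdI[of "gauss 0" 1]) (auto simp: red_gauss_trivial)

lemma gauss_mult_ldvd:
  assumes "ldvd (gauss a) x"
  shows "ldvd (gauss (c * a)) (x ^ c)"
proof (induction c)
  case (Suc c)
  show ?case using ldvd_trans[OF gauss_add_ldvd ldvd_mult[OF assms Suc]] by simp
qed (simp add: gauss_0_ldvd)

text \<open>The easy half of Stickelberger: each unit of weight at place \<open>i\<close> costs one
  factor \<open>gauss (p ^ i) = gauss 1\<close>.\<close>

lemma gauss_digits_ldvd:
  assumes "q > 2"
  shows "ldvd (gauss (\<Sum>i<m. c i * p ^ i)) (\<pi> ^ (\<Sum>i<m. c i))"
proof (induction m)
  case (Suc m)
  have "ldvd (gauss (p ^ m)) \<pi>"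
    using gauss_1_ldvd[OF assms] gauss_frobenius_power[of m 1] by simp
  from ldvd_trans[OF gauss_add_ldvd ldvd_mult[OF Suc gauss_mult_ldvd[OF this]]]
  show ?case by (simp add: power_add)
qed (simp add: gauss_0_ldvd)

section \<open>The Fourier transform of the Weil sum\<close>

lemma weil_sum_transform:
  assumes d: "coprime d (q - 1)" "d > 0" and ab: "(q - 1) dvd d * a + b" and b: "\<not> (q - 1) dvd b"
  shows "(\<Sum>c\<in>UNIV - {0}. T (inverse c) ^ b * weil_sum d c) = T (- 1) ^ b * gauss a * gauss b"
proof -
  \<comment> \<open>Substituting \<open>e = - c * x\<close> yields
    \<open>T (- x) ^ b * gauss b\<close>. Since \<open>x ^ (d * a + b) = 1\<close>, the factor
    \<open>T x ^ b\<close> becomes a function of \<open>x ^ d\<close>, which can then be reindexed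
    as a new variable.\<close>
  have inner: "(\<Sum>c\<in>UNIV - {0}. T (inverse c) ^ b * \<psi> (- c * x))
      = (if x = 0 then 0 else T (- 1) ^ b * T (inverse (x ^ d)) ^ a * gauss b)" for x
  proof (cases "x = 0")
    case True
    thus ?thesis using sum_T_eq_0[OF b] by (simp flip: sum_distrib_right)
  next
    case False
    have "(T x) ^ b * T x ^ (d * a) = T (x ^ (d * a + b))"
      by (simp add: T_power T_mult power_add mult.commute)
    also have "x ^ (d * a + b) = 1"
      using ab False by (auto elim!: dvdE simp: power_mult fermat[unfolded One_nat_def])
    finally have 1: "(T x) ^ b * T x ^ (d * a) = 1" by simp
    have "T (inverse (x ^ d)) ^ a * T x ^ (d * a) = T (inverse (x ^ d) * x ^ d) ^ a"
      by (simp add: T_mult T_power power_mult power_mult_distrib)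
    hence "T (inverse (x ^ d)) ^ a * T x ^ (d * a) = 1" using False by simp
    hence Tx: "T x ^ b = T (inverse (x ^ d)) ^ a" using 1
      by (metis mult_cancel_right zero_neq_one mult_zero_right)
    have "(\<Sum>c\<in>UNIV - {0}. T (inverse c) ^ b * \<psi> (- c * x))
      = (\<Sum>e\<in>UNIV - {0}. T (- x * inverse e) ^ b * \<psi> e)"
      by (rule sum.reindex_bij_witness[of _ "\<lambda>e. - e / x" "\<lambda>c. - c * x"])
        (use False in \<open>auto simp: field_simps\<close>)
    also have "\<dots> = (\<Sum>e\<in>UNIV - {0}. T (- 1) ^ b * T x ^ b * (T (inverse e) ^ b * \<psi> e))"
    proof (intro sum.cong refl)
      fix e
      have "T (- x * inverse e) = T (- 1) * T x * T (inverse e)"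
        unfolding T_mult[symmetric] by simp
      thus "T (- x * inverse e) ^ b * \<psi> e = T (- 1) ^ b * T x ^ b * (T (inverse e) ^ b * \<psi> e)"
        by (simp add: power_mult_distrib mult_ac)
    qed
    finally show ?thesis using False by (simp add: gauss_def sum_distrib_left Tx)
  qed
  have "(\<Sum>c\<in>UNIV - {0}. T (inverse c) ^ b * weil_sum d c)
     = (\<Sum>c\<in>UNIV - {0}. \<Sum>x\<in>UNIV. \<psi> (x ^ d) * (T (inverse c) ^ b * \<psi> (- c * x)))"
  proof (intro sum.cong refl)
    fix c
    have "\<psi> (x ^ d - c * x) = \<psi> (x ^ d) * \<psi> (- c * x)" for x
      using char_add[of "x ^ d" "- c * x"] by simp
    thus "T (inverse c) ^ b * weil_sum d c
        = (\<Sum>x\<in>UNIV. \<psi> (x ^ d) * (T (inverse c) ^ b * \<psi> (- c * x)))"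
      by (simp add: weil_sum_def sum_distrib_left mult_ac)
  qed
  also have "\<dots> = (\<Sum>x\<in>UNIV. \<psi> (x ^ d) * (\<Sum>c\<in>UNIV - {0}. T (inverse c) ^ b * \<psi> (- c * x)))"
    by (subst sum.swap) (simp add: sum_distrib_left)
  also have "\<dots> = (\<Sum>x\<in>UNIV - {0}. T (- 1) ^ b * gauss b * (T (inverse (x ^ d)) ^ a * \<psi> (x ^ d)))"
    unfolding inner by (intro sum.mono_neutral_cong_right) auto
  also have "\<dots> = T (- 1) ^ b * gauss b * gauss a"
    using sum_power_reindex[OF d, of "\<lambda>x. T (inverse x) ^ a * \<psi> x"]
    by (simp add: gauss_def flip: sum_distrib_left)
  finally show ?thesis by (simp add: mult_ac)
qed

text \<open>If all Weil sums were divisible by \<open>\<pi> ^ Suc K\<close>, so would be their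
  transform \<open>gauss a * gauss b\<close> up to sign. But that product locally divides
  \<open>\<pi> ^ K\<close>; cancelling makes \<pi> divide a local unit.\<close>

lemma exists_weil_sum_not_divisible:
  assumes "q > 2" and d: "coprime d (q - 1)" "d > 0"
    and ab: "(q - 1) dvd d * a + b" and b: "\<not> (q - 1) dvd b"
    and a_eq: "a = (\<Sum>i<n. ad i * p ^ i)" and b_eq: "b = (\<Sum>i<n. bd i * p ^ i)"
    and K: "K = (\<Sum>i<n. ad i) + (\<Sum>i<n. bd i)"
  shows "\<exists>c :: 'a. \<forall>r\<in>R. weil_sum d c \<noteq> \<pi> ^ Suc K * r"
proof (rule ccontr)
  assume "\<not> ?thesis"
  hence "\<forall>c :: 'a. \<exists>r. r \<in> R \<and> weil_sum d c = \<pi> ^ Suc K * r" by blast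
  then obtain r where r: "\<And>c :: 'a. r c \<in> R" "\<And>c. weil_sum d c = \<pi> ^ Suc K * r c" by metis
  define S where "S = (\<Sum>c\<in>UNIV - {0}. T (inverse c) ^ b * r c)"
  have S: "S \<in> R" unfolding S_def using r by auto
  have "ldvd (gauss a * gauss b) (\<pi> ^ K)"
    using ldvd_mult[OF gauss_digits_ldvd[OF assms(1)] gauss_digits_ldvd[OF assms(1)]]
    unfolding a_eq b_eq K power_add by blast
  then obtain u s where us: "u \<in> R" "s \<in> R" "red u \<noteq> 0" "u * \<pi> ^ K = s * (gauss a * gauss b)"
    unfolding ldvd_def by blast
  have T1: "T (- 1) * T (- 1) = 1" by (simp flip: T_mult)
  have "T (- 1) ^ b * T (- 1) ^ b = 1" by (simp add: T1 flip: power_mult_distrib)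
  hence "u * \<pi> ^ K = s * T (- 1) ^ b * (T (- 1) ^ b * gauss a * gauss b)"
    using us(4) by (simp add: mult_ac)
  also have "T (- 1) ^ b * gauss a * gauss b = \<pi> ^ Suc K * S"
    unfolding weil_sum_transform[OF d ab b, symmetric] r(2) S_def
    by (simp add: sum_distrib_left mult_ac)
  also have "s * T (- 1) ^ b * (\<pi> ^ Suc K * S) = (\<pi> * (s * T (- 1) ^ b * S)) * \<pi> ^ K"
    by simp
  finally have "u = \<pi> * (s * T (- 1) ^ b * S)" using pi_nonzero by simp
  hence "red u = red \<pi> * red (s * T (- 1) ^ b * S)" using us S by simp
  thus False using us(3) by simp
qed

section \<open>From divisibility in \<open>R\<close> to the valuation \<open>val_p\<close>\<close>

lemma of_int_in [simp, intro]: "of_int k \<in> R" and red_of_int [simp]: "red (of_int k) = of_int k"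
proof -
  have nat: "of_nat m \<in> R \<and> red (of_nat m) = of_nat m" for m by (induction m) auto
  have "of_int k \<in> R \<and> red (of_int k) = of_int k"
    by (cases k rule: int_cases2) (use nat in auto)
  thus "of_int k \<in> R" "red (of_int k) = of_int k" by auto
qed

lemma ipoly_zeta_in [simp, intro]: "ipoly h (zeta p) \<in> R"
  and red_ipoly_zeta [simp]: "red (ipoly h (zeta p)) = of_int (poly h 1)"
proof -
  have "ipoly h (zeta p) \<in> R \<and> red (ipoly h (zeta p)) = of_int (poly h 1)"
    by (induction h) auto
  thus "ipoly h (zeta p) \<in> R" "red (ipoly h (zeta p)) = of_int (poly h 1)" by auto
qed

lemma cyclotomic_intsI [intro]: "ipoly h (zeta p) \<in> cyclotomic_ints p"
  by (simp add: cyclotomic_ints_def)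

lemma cyclotomic_intsE [elim]:
  assumes "z \<in> cyclotomic_ints p" obtains h where "z = ipoly h (zeta p)"
  using assms by (auto simp: cyclotomic_ints_def)

lemma exists_p_eq_pi_mult: "\<exists>h. of_nat p = \<pi> * ipoly h (zeta p)"
proof
  have "(zeta p - 1) * (\<Sum>i<p. zeta p ^ i) = 0"
    using power_diff_1_eq[of "zeta p" p] prime_gt_0_nat[OF prime_p] by simp
  hence "(\<Sum>i<p. zeta p ^ i) = 0" using pi_nonzero by auto
  hence "of_nat p = (\<Sum>i<p. 1 - zeta p ^ i)" by (simp add: sum_subtractf)
  also have "\<dots> = (\<Sum>i<p. \<pi> * (\<Sum>j<i. zeta p ^ j))"
    by (intro sum.cong refl) (simp add: one_diff_power_eq)
  also have "\<dots> = \<pi> * ipoly (\<Sum>i<p. \<Sum>j<i. [:0, 1:] ^ j) (zeta p)"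
    by (simp add: sum_distrib_left)
  finally show "of_nat p = \<pi> * ipoly (\<Sum>i<p. \<Sum>j<i. [:0, 1:] ^ j) (zeta p)" .
qed

text \<open>Since \<open>zeta p\<close> reduces to \<open>1\<close>, a vanishing reduction of
  \<open>ipoly h (zeta p)\<close> means that \<open>p\<close> divides \<open>poly h 1\<close>. Both
  \<open>p\<close> and the value of \<open>h - [:poly h 1:]\<close> are multiples of \<pi>, so the
  element would lie in the ideal of \<pi>.\<close>

lemma prime_to_p_red:
  assumes "a \<in> prime_to_p p"
  shows "a \<in> R" "red a \<noteq> 0"
proof -
  obtain h where h: "a = ipoly h (zeta p)" using assms by (auto simp: prime_to_p_def)
  thus "a \<in> R" by simp
  show "red a \<noteq> 0"
  proof
    assume "red a = 0"
    hence "of_int (poly h 1) = (0 :: 'a)" using h by simp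
    hence "int p dvd poly h 1"
      using of_int_eq_iff_cong_CHAR[of "poly h 1" 0, where ?'a = 'a]
      by (simp add: char_eq cong_0_iff)
    then obtain c where c: "poly h 1 = int p * c" by blast
    obtain w where w: "of_nat p = \<pi> * ipoly w (zeta p)" using exists_p_eq_pi_mult by blast
    have "poly (h - [:poly h 1:]) 1 = 0" by simp
    then obtain k where k: "h - [:poly h 1:] = [:- 1, 1:] * k"
      unfolding poly_eq_0_iff_dvd by blast
    have "a - of_int (poly h 1) = ipoly (h - [:poly h 1:]) (zeta p)" by (simp add: h)
    also have "\<dots> = \<pi> * (- ipoly k (zeta p))" unfolding k by (simp add: algebra_simps)
    finally have "a = of_nat p * of_int c - \<pi> * ipoly k (zeta p)" by (simp add: c algebra_simps)
    also have "\<dots> = \<pi> * ipoly (smult c w - k) (zeta p)" unfolding w by (simp add: algebra_simps)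
    finally show False using assms unfolding prime_to_p_def by blast
  qed
qed

lemma one_prime_to_p: "1 \<in> prime_to_p p"
proof -
  have "1 \<noteq> \<pi> * u" if "u \<in> cyclotomic_ints p" for u
  proof
    assume "1 = \<pi> * u"
    moreover have "u \<in> R" using that by auto
    ultimately have "red 1 = red \<pi> * red u" using red_mult[of \<pi> u] by auto
    thus False by simp
  qed
  moreover have "1 \<in> cyclotomic_ints p" using cyclotomic_intsI[of 1] by simp
  ultimately show ?thesis by (auto simp: prime_to_p_def)
qed

text \<open>A larger exponent on the right would make \<pi> divide \<open>a * b'\<close>, whose
  reduction is nonzero. Used in both directions, this makes the exponent in \<open>val_p\<close>
  unique.\<close>

lemma pi_powi_unique:
  assumes "a \<in> prime_to_p p" "b \<in> prime_to_p p" "a' \<in> prime_to_p p" "b' \<in> prime_to_p p"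
    and eq: "\<pi> powi k * a / b = \<pi> powi k' * a' / b'"
  shows "k' \<le> k"
proof (rule ccontr)
  assume "\<not> k' \<le> k"
  define m where "m = nat (k' - k) - 1"
  have m: "k' = k + int (Suc m)" using \<open>\<not> k' \<le> k\<close> by (simp add: m_def)
  note in_R = prime_to_p_red[OF assms(1)] prime_to_p_red[OF assms(2)]
    prime_to_p_red[OF assms(3)] prime_to_p_red[OF assms(4)]
  have nz: "b \<noteq> 0" "b' \<noteq> 0" using in_R by auto
  have "\<pi> powi k' = \<pi> powi k * \<pi> ^ Suc m"
    unfolding m by (subst power_int_add) (use pi_nonzero in \<open>auto simp only: power_int_of_nat\<close>)
  moreover have "\<pi> powi k * a * b' = \<pi> powi k' * a' * b"
    using eq by (simp only: frac_eq_eq[OF nz])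
  ultimately have "\<pi> powi k * (a * b') = \<pi> powi k * (\<pi> * (\<pi> ^ m * a' * b))"
    by (simp only: mult_ac power_Suc)
  hence "a * b' = \<pi> * (\<pi> ^ m * a' * b)" using pi_nonzero by simp
  hence "red (a * b') = red \<pi> * red (\<pi> ^ m * a' * b)" using in_R by simp
  thus False using in_R by simp
qed

text \<open>The exponent in \<open>val_p\<close> is the largest power of \<pi> dividing
  \<open>z\<close> within the cyclotomic integers; as these lie in \<open>R\<close>, it is at most
  \<open>K\<close>.\<close>

lemma val_p_le:
  assumes z: "z \<in> cyclotomic_ints p" and nd: "\<forall>r\<in>R. z \<noteq> \<pi> ^ Suc K * r"
  shows "val_p p z \<le> ereal (real K / (real p - 1))"
proof -
  have z0: "z \<noteq> 0" using nd by auto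
  define P where "P = (\<lambda>k. \<exists>u\<in>cyclotomic_ints p. z = \<pi> ^ k * u)"
  have "P 0" using z by (simp add: P_def)
  have bound: "k \<le> K" if Pk: "P k" for k
  proof (rule ccontr)
    assume "\<not> k \<le> K"
    hence k: "k = Suc K + (k - Suc K)" by simp
    obtain u where u: "u \<in> cyclotomic_ints p" "z = \<pi> ^ k * u" using Pk by (auto simp: P_def)
    have "z = \<pi> ^ Suc K * (\<pi> ^ (k - Suc K) * u)" unfolding u(2)
      by (subst k) (simp only: power_add mult.assoc)
    thus False using nd u(1) by blast
  qed
  define k where "k = (GREATEST k. P k)"
  have "P k" unfolding k_def using GreatestI_nat[of P 0 K] \<open>P 0\<close> bound by blast
  then obtain a where a: "a \<in> cyclotomic_ints p" "z = \<pi> ^ k * a" by (auto simp: P_def)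
  have "a \<noteq> \<pi> * u" if "u \<in> cyclotomic_ints p" for u
  proof
    assume "a = \<pi> * u"
    hence "P (Suc k)" unfolding P_def using a that by (intro bexI[of _ u]) (auto simp: mult_ac)
    hence "Suc k \<le> k" unfolding k_def using Greatest_le_nat[of P "Suc k" K] bound by (simp add: k_def)
    thus False by simp
  qed
  hence ap: "a \<in> prime_to_p p" using a(1) by (auto simp: prime_to_p_def)
  have "(THE k :: int. \<exists>a\<in>prime_to_p p. \<exists>b\<in>prime_to_p p. z = \<pi> powi k * a / b) = int k"
  proof (rule the_equality)
    have eq: "z = \<pi> powi (int k) * a / 1" using a by simp
    thus "\<exists>a\<in>prime_to_p p. \<exists>b\<in>prime_to_p p. z = \<pi> powi (int k) * a / b"
      using ap one_prime_to_p by blast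
    fix j assume "\<exists>a\<in>prime_to_p p. \<exists>b\<in>prime_to_p p. z = \<pi> powi j * a / b"
    then obtain a' b' where ab: "a' \<in> prime_to_p p" "b' \<in> prime_to_p p" "z = \<pi> powi j * a' / b'"
      by blast
    show "j = int k"
      using pi_powi_unique[OF ap one_prime_to_p ab(1,2), of "int k" j]
        pi_powi_unique[OF ab(1,2) ap one_prime_to_p, of j "int k"] eq ab(3) by simp
  qed
  hence "val_p p z = ereal (real k / (real p - 1))" using z0 by (simp add: val_p_def)
  moreover have "real k / (real p - 1) \<le> real K / (real p - 1)"
    using bound[OF \<open>P k\<close>] prime_gt_1_nat[OF prime_p] by (intro divide_right_mono) auto
  ultimately show ?thesis by simp
qed

lemma weil_sum_cyclotomic: "weil_sum d (c :: 'a) \<in> cyclotomic_ints p"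
proof -
  have "weil_sum d c = ipoly (\<Sum>x\<in>UNIV. [:0, 1:] ^ trace_rep (x ^ d - c * x)) (zeta p)"
    by (simp add: weil_sum_def char_eq_zeta)
  thus ?thesis by (simp only: cyclotomic_intsI)
qed

lemma weil_val_le:
  assumes "q > 2" and d: "coprime d (q - 1)" "d > 0"
    and ab: "(q - 1) dvd d * (\<Sum>i<n. ad i * p ^ i) + (\<Sum>i<n. bd i * p ^ i)"
    and a: "\<not> (q - 1) dvd (\<Sum>i<n. ad i * p ^ i)"
  shows "weil_val TYPE('a) d \<le> ereal (real ((\<Sum>i<n. ad i) + (\<Sum>i<n. bd i)) / (real p - 1))"
proof -
  \<comment> \<open>If \<open>q - 1\<close> divided \<open>b\<close>, it would divide
    \<open>d * a\<close> and hence, by coprimality, \<open>a\<close>.\<close>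
  have b: "\<not> (q - 1) dvd (\<Sum>i<n. bd i * p ^ i)"
    using a ab d(1) by (metis coprime_commute coprime_dvd_mult_right_iff dvd_add_left_iff)
  obtain c :: 'a where c: "\<forall>r\<in>R. weil_sum d c \<noteq>
      \<pi> ^ Suc ((\<Sum>i<n. ad i) + (\<Sum>i<n. bd i)) * r"
    using exists_weil_sum_not_divisible[OF assms(1) d ab b refl refl refl] by blast
  have "weil_val TYPE('a) d \<le> val_p p (weil_sum d c)"
    unfolding weil_val_def char_eq by (intro Min_le) auto
  also have "\<dots> \<le> ereal (real ((\<Sum>i<n. ad i) + (\<Sum>i<n. bd i)) / (real p - 1))"
    using val_p_le[OF weil_sum_cyclotomic c] .
  finally show ?thesis .
qed

end

section \<open>Periodic digit patterns and the case distinction\<close>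

lemma power_minus_one_eq_nat:
  fixes x :: nat
  assumes "x > 0"
  shows "x ^ m - 1 = (x - 1) * (\<Sum>i<m. x ^ i)"
proof -
  have "int (x ^ m - 1) = int ((x - 1) * (\<Sum>i<m. x ^ i))"
    using assms power_diff_1_eq[of "int x" m] by (simp add: of_nat_diff Suc_le_eq)
  thus ?thesis by (simp only: of_nat_eq_iff)
qed

context gauss_sums
begin

text \<open>Constant digits give \<open>k * N\<close> and \<open>l * N\<close> with
  \<open>q - 1 = (p - 1) * N\<close>, so the condition modulo \<open>q - 1\<close> becomes one
  modulo \<open>p - 1\<close>.\<close>

lemma weil_val_le_constant_digits:
  assumes "q > 2" and d: "coprime d (q - 1)" "d > 0"
    and kl: "(p - 1) dvd d * k + l" and k: "\<not> (p - 1) dvd k"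
  shows "weil_val TYPE('a) d \<le> ereal (real (k + l) / (real p - 1) * real n)"
proof -
  define N where "N = (\<Sum>i<n. p ^ i)"
  have q: "q - 1 = (p - 1) * N"
    unfolding N_def q_eq using prime_gt_0_nat[OF prime_p] by (rule power_minus_one_eq_nat)
  have N0: "N > 0" using q assms(1) by (cases N) auto
  have sum: "(\<Sum>i<n. c * p ^ i) = c * N" for c by (simp add: N_def sum_distrib_left)
  have "(q - 1) dvd d * (\<Sum>i<n. k * p ^ i) + (\<Sum>i<n. l * p ^ i)"
    unfolding sum q using kl by (simp add: mult_dvd_mono flip: mult.assoc distrib_right)
  moreover have "\<not> (q - 1) dvd (\<Sum>i<n. k * p ^ i)"
    unfolding sum q using N0 k by simp
  ultimately have "weil_val TYPE('a) d
      \<le> ereal (real ((\<Sum>i<n. k) + (\<Sum>i<n. l)) / (real p - 1))"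
    by (intro weil_val_le[OF assms(1) d])
  thus ?thesis by (simp add: algebra_simps add_divide_distrib)
qed

lemma weil_val_le_alternating_digits:
  assumes "q > 2" and d: "coprime d (q - 1)" "d > 0" and n: "n = 2 * h"
    and ab: "(p\<^sup>2 - 1) dvd d * (a0 + a1 * p) + (b0 + b1 * p)"
    and a: "\<not> (p\<^sup>2 - 1) dvd a0 + a1 * p"
  shows "weil_val TYPE('a) d \<le> ereal (real (a0 + a1 + b0 + b1) / (real p - 1) * real h)"
proof -
  define N where "N = (\<Sum>i<h. (p\<^sup>2) ^ i)"
  define alt where "alt = (\<lambda>c0 c1 i :: nat. if even i then c0 else c1 :: nat)"
  have q: "q - 1 = (p\<^sup>2 - 1) * N"
    unfolding N_def q_eq n power_mult
    by (rule power_minus_one_eq_nat) (use prime_gt_0_nat[OF prime_p] in simp)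
  have N0: "N > 0" using q assms(1) by (cases N) auto
  have weighted: "(\<Sum>i<2 * j. alt c0 c1 i * p ^ i) = (c0 + c1 * p) * (\<Sum>i<j. (p\<^sup>2) ^ i)" for c0 c1 j
    by (induction j) (simp_all add: alt_def algebra_simps power_mult[symmetric])
  have plain: "(\<Sum>i<2 * j. alt c0 c1 i) = (c0 + c1) * j" for c0 c1 j
    by (induction j) (simp_all add: alt_def)
  have "(q - 1) dvd d * (\<Sum>i<n. alt a0 a1 i * p ^ i) + (\<Sum>i<n. alt b0 b1 i * p ^ i)"
    unfolding n weighted N_def[symmetric] q using ab
    by (simp only: mult_dvd_mono dvd_refl flip: mult.assoc distrib_right)
  moreover have "\<not> (q - 1) dvd (\<Sum>i<n. alt a0 a1 i * p ^ i)"
    unfolding n weighted N_def[symmetric] q using N0 a by simp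
  ultimately have "weil_val TYPE('a) d
      \<le> ereal (real ((\<Sum>i<n. alt a0 a1 i) + (\<Sum>i<n. alt b0 b1 i)) / (real p - 1))"
    by (intro weil_val_le[OF assms(1) d])
  thus ?thesis unfolding n plain by (simp add: algebra_simps add_divide_distrib)
qed

end

theorem theorem5p1:
  fixes p n d q :: nat
  assumes "CHAR('a::finite_field) = p"
    and "CARD('a) = q"
    and "q = p ^ n"
    and "d > 0"
    and "gcd d (q - 1) = 1"
    and "\<not> [d = 1] (mod (p - 1))"
  shows "([d = (p + 1) div 2] (mod (p - 1)) \<longrightarrow> [p = 1] (mod 4)) \<and>
    (if [d = (p + 1) div 2] (mod (p - 1)) \<and> odd n
     then weil_val TYPE('a) d \<le> ereal (1 / 2 * real n)
     else weil_val TYPE('a) d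
            \<le> ereal (1 / (real p - 1) * of_int \<lceil>(real p - 1) / 3\<rceil> * real n))"
proof -
  obtain R and red :: "complex \<Rightarrow> 'a" and T where "teichmueller R red T"
    using exists_teichmueller by blast
  then interpret gauss_sums R red T p q n
    using assms(1-3) by (simp add: gauss_sums_def gauss_sums_axioms_def)
  have cop: "coprime d (q - 1)" using assms(5) by (simp add: coprime_iff_gcd_eq_1)
  have pq: "(p - 1) dvd (q - 1)"
    unfolding q_eq power_minus_one_eq_nat[OF prime_gt_0_nat[OF prime_p]] by simp
  have cop_p: "coprime d (p - 1)" using coprime_divisors[OF dvd_refl pq cop] .
  \<comment> \<open>Modulo \<open>p - 1 = 1\<close> every congruence holds.\<close>
  have "p \<noteq> 2" using assms(6) by auto
  hence odd_p: "odd p" using prime_odd_nat[OF prime_p] prime_ge_2_nat[OF prime_p] by simp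
  hence odd_d: "odd d" using coprime_common_divisor[OF cop_p, of 2] by auto
  have "p \<noteq> 3"
  proof
    assume "p = 3"
    hence "[d = 1] (mod (p - 1))" using odd_d by (simp add: cong_def odd_iff_mod_2_eq_one)
    thus False using assms(6) by blast
  qed
  hence p5: "p \<ge> 5" using odd_p \<open>p \<noteq> 2\<close> prime_ge_2_nat[OF prime_p] by presburger
  have p3: "p mod 3 \<noteq> 0"
    using primes_dvd_imp_eq[of 3 p] prime_p \<open>p \<noteq> 3\<close> by (auto simp: mod_eq_0_iff_dvd)
  have "p ^ 1 \<le> p ^ n" using n_pos p5 by (intro power_increasing) auto
  hence q2: "q > 2" using q_eq p5 by simp
  have p1: "real p - 1 > 0" using p5 by simp
  \<comment> \<open>\<open>3 * w <= p + 1\<close> means that \<open>w - 1\<close> is below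
    \<open>(p - 1) / 3\<close>, so the integer \<open>w\<close> is at most the ceiling.\<close>
  have bound: "weil_val TYPE('a) d \<le> ereal (1 / (real p - 1) * of_int \<lceil>(real p - 1) / 3\<rceil> * real n)"
    if val: "weil_val TYPE('a) d \<le> ereal (real w / (real p - 1) * real n)" and w: "3 * w \<le> p + 1" for w
  proof -
    have "real w - 1 < (real p - 1) / 3" using w by simp
    hence "int w \<le> \<lceil>(real p - 1) / 3\<rceil>" by linarith
    hence "real w \<le> of_int \<lceil>(real p - 1) / 3\<rceil>" by linarith
    hence "real w / (real p - 1) * real n \<le> of_int \<lceil>(real p - 1) / 3\<rceil> / (real p - 1) * real n"
      using p1 by (intro mult_right_mono divide_right_mono) auto
    thus ?thesis using val by (auto intro: order_trans)
  qed
  define H where "H = (p + 1) div 2"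
  have pH: "p = 2 * H - 1" "H \<ge> 3" using odd_p p5 by (auto simp: H_def elim!: oddE)
  have mod4: "[p = 1] (mod 4)" if "[d = H] (mod (p - 1))"
  proof -
    have "even (p - 1)" using odd_p by simp
    hence "[d = H] (mod 2)" using that cong_dvd_modulus_nat by blast
    hence "odd H" using odd_d by (auto simp: cong_def odd_iff_mod_2_eq_one)
    thus ?thesis using pH by (auto simp: cong_def elim!: oddE)
  qed
  \<comment> \<open>Digits \<open>1\<close> and \<open>H - 2\<close> work, as
    \<open>H + (H - 2) = p - 1\<close>.\<close>
  have half: "weil_val TYPE('a) d \<le> ereal (real (H - 1) / (real p - 1) * real n)"
    if "[d = H] (mod (p - 1))"
  proof -
    have "[d * 1 + (H - 2) = H * 1 + (H - 2)] (mod (p - 1))"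
      using that by (intro cong_add cong_mult) auto
    moreover have "H * 1 + (H - 2) = p - 1" using pH by simp
    ultimately have "(p - 1) dvd d * 1 + (H - 2)" by (simp add: cong_def dvd_eq_mod_eq_0)
    moreover have "\<not> (p - 1) dvd 1" using p5 by simp
    ultimately show ?thesis
      using weil_val_le_constant_digits[OF q2 cop assms(4), of 1 "H - 2"] pH by simp
  qed
  have real_H: "real (H - 1) / (real p - 1) = 1 / 2" using pH by (simp add: field_simps of_nat_diff)
  have generic: "weil_val TYPE('a) d \<le> ereal (1 / (real p - 1) * of_int \<lceil>(real p - 1) / 3\<rceil> * real n)"
    if nc: "\<not> [d = H] (mod (p - 1))"
  proof -
    have m: "int p - 1 = int (p - 1)" using p5 by simp
    have "\<exists>k l. k \<ge> 0 \<and> l \<ge> 0 \<and> 3 * (k + l) \<le> (int p - 1) + 2 \<and>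
        (int p - 1) dvd int d * k + l \<and> \<not> (int p - 1) dvd k"
    proof (rule exists_small_weight_pair)
      show "(int p - 1) mod 3 \<noteq> 2" using p3 by presburger
      have c: "(int p - 1) dvd int d - int e \<longleftrightarrow> [d = e] (mod (p - 1))" for e
        unfolding m by (simp add: cong_iff_dvd_diff flip: cong_int_iff)
      show "\<not> (int p - 1) dvd int d - 1" using c[of 1] assms(6) by simp
      have H_int: "int d - 1 - (int p - 1) div 2 = int d - int H" using pH by simp
      show "\<not> (int p - 1) dvd int d - 1 - (int p - 1) div 2" unfolding H_int c by (rule nc)
    qed (use p5 odd_p odd_d in auto)
    then obtain k' l' where kl': "k' \<ge> 0" "l' \<ge> 0" "3 * (k' + l') \<le> (int p - 1) + 2"
        "(int p - 1) dvd int d * k' + l'" "\<not> (int p - 1) dvd k'" by blast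
    define k l where "k = nat k'" and "l = nat l'"
    have kl: "k' = int k" "l' = int l" using kl' by (auto simp: k_def l_def)
    have "(p - 1) dvd d * k + l" "\<not> (p - 1) dvd k"
      using kl'(4,5) unfolding kl m by (simp_all flip: of_nat_mult of_nat_add)
    moreover have "3 * (k + l) \<le> p + 1" using kl'(3) unfolding kl by presburger
    ultimately show ?thesis using weil_val_le_constant_digits[OF q2 cop assms(4)] bound by blast
  qed
  have even_case: "weil_val TYPE('a) d \<le> ereal (1 / (real p - 1) * of_int \<lceil>(real p - 1) / 3\<rceil> * real n)"
    if dH: "[d = H] (mod (p - 1))" and n: "even n"
  proof (cases "p = 5")
    \<comment> \<open>For \<open>p = 5\<close> the half bound has \<open>w = H - 1 = 2\<close>,
      which already meets \<open>3 * w <= p + 1\<close>.\<close>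
    case True
    thus ?thesis using half[OF dH] bound[of "H - 1"] pH by simp
  next
    case False
    have "p \<noteq> 9" using p3 by auto
    have "p mod 4 = 1" using mod4[OF dH] by (simp add: cong_def)
    then obtain r where r: "p = 4 * r + 1" by (metis mult_div_mod_eq)
    \<comment> \<open>With \<open>5\<close> and \<open>9\<close> excluded, the congruence modulo
      \<open>4\<close> gives \<open>p >= 13\<close>, as the two-digit witnesses require.\<close>
    hence "r \<noteq> 0" "r \<noteq> 1" "r \<noteq> 2" using p5 False \<open>p \<noteq> 9\<close> by auto
    hence H7: "H \<ge> 7" using r by (simp add: H_def)
    obtain h where h: "n = 2 * h" using n by blast
    have p_int: "int p = 2 * int H - 1" using pH by simp
    have P_int: "(int p)\<^sup>2 - 1 = int (p\<^sup>2 - 1)"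
      using p5 by (simp add: of_nat_diff)
    have p2q: "(p\<^sup>2 - 1) dvd (q - 1)"
      unfolding q_eq h power_mult using power_minus_one_eq_nat[of "p\<^sup>2" h] p5 by simp
    have "coprime d (p\<^sup>2 - 1)" using coprime_divisors[OF dvd_refl p2q cop] .
    hence cop': "coprime (int d) ((2 * int H - 1)\<^sup>2 - 1)"
      unfolding p_int[symmetric] P_int by (simp only: coprime_int_iff)
    have "2 * int H - 2 = int (p - 1)" using pH by simp
    hence "[int d = int H] (mod (2 * int H - 2))" using dH by (simp add: cong_int_iff)
    from exists_small_weight_two_digits[OF _ cop' this] H7
    obtain a0 a1 b0 b1 where *: "a0 \<ge> 0" "a1 \<ge> 0" "b0 \<ge> 0" "b1 \<ge> 0" "a0 + a1 + b0 + b1 = int H - 1"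
      "(2 * int H - 1)\<^sup>2 - 1 dvd int d * (a0 + a1 * (2 * int H - 1)) + (b0 + b1 * (2 * int H - 1))"
      "0 < a0 + a1 * (2 * int H - 1)" "a0 + a1 * (2 * int H - 1) < (2 * int H - 1)\<^sup>2 - 1"
      by auto
    define A0 A1 B0 B1 where "A0 = nat a0" "A1 = nat a1" "B0 = nat b0" "B1 = nat b1"
    hence eqs: "a0 = int A0" "a1 = int A1" "b0 = int B0" "b1 = int B1" using * by auto
    have dv: "(p\<^sup>2 - 1) dvd d * (A0 + A1 * p) + (B0 + B1 * p)"
      using *(6) unfolding eqs p_int[symmetric] P_int
      by (simp only: of_nat_dvd_iff flip: of_nat_mult of_nat_add)
    have "0 < A0 + A1 * p" "A0 + A1 * p < p\<^sup>2 - 1"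
      using *(7,8) unfolding eqs p_int[symmetric] P_int
      by (simp_all only: of_nat_less_iff of_nat_0_less_iff flip: of_nat_mult of_nat_add)
    hence nd: "\<not> (p\<^sup>2 - 1) dvd A0 + A1 * p" by (auto dest!: dvd_imp_le)
    have "A0 + A1 + B0 + B1 = H - 1" using *(5) H7 unfolding eqs by linarith
    hence "weil_val TYPE('a) d \<le> ereal (real (H - 1) / (real p - 1) * real h)"
      using weil_val_le_alternating_digits[OF q2 cop assms(4) h dv nd] by simp
    \<comment> \<open>Spread over two digits, the weight \<open>H - 1\<close> amounts to at most
      \<open>w = H div 2\<close> per digit.\<close>
    also have "\<dots> \<le> ereal (real (H div 2) / (real p - 1) * real n)"
    proof -
      have "H - 1 \<le> 2 * (H div 2)" by presburger
      hence "real (H - 1) \<le> 2 * real (H div 2)" by linarith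
      hence "real (H - 1) / (real p - 1) * real h \<le> (2 * real (H div 2)) / (real p - 1) * real h"
        using p1 by (intro mult_right_mono divide_right_mono) auto
      thus ?thesis by (simp add: h mult_ac)
    qed
    finally show ?thesis by (rule bound) (use pH in presburger)
  qed
  show ?thesis
    using mod4 half[unfolded real_H] generic even_case
    unfolding H_def[symmetric] if_bool_eq_conj by blast
qed

end
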